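(* For each integer $n>5$, the graded Lie algebra $\mathfrak g=\mathfrak{gl}_2(\mathbb R)\rtimes\mathfrak{heis}_{2n-5}$ with grading $$\mathrm{wght}(Y)=1,\quad \mathrm{wght}(H)=\mathrm{wght}(E)=0,\quad \mathrm{wght}(X)=-1,\quad \mathrm{wght}(\varepsilon_i)=-i\ (1\le i\le 2n-6),\quad \mathrm{wght}(\eta)=-2n+5$$ has a linear invariant normalization condition.
   Context: The Lie algebra $\mathfrak{gl}_2(\mathbb R)\rtimes\mathfrak{heis}_{2n-5}$: $\mathfrak{gl}_2(\mathbb R)$ has basis $Y,H,E,X$ with nontrivial brackets $[X,Y]=H$, $[H,X]=2X$, $[H,Y]=-2Y$ ($E$ central). $\mathfrak{heis}_{2n-5}$ has basis $\varepsilon_1,\dots,\varepsilon_{2n-6},\eta$ with nontrivial brackets $[\varepsilon_i,\varepsilon_{2n-5-i}]=(-1)^i\eta$, $1\le i\le 2n-6$. $\mathfrak{gl}_2(\mathbb R)$ acts on $\mathfrak{heis}_{2n-5}$ by derivations: $[H,\varepsilon_i]=(2i+5-2n)\varepsilon_i$, $[H,\eta]=0$; $[E,\varepsilon_i]=\varepsilon_i$, $[E,\eta]=2\eta$; $[X,\varepsilon_i]=\varepsilon_{i+1}$ for $1\le i\le 2n-7$, $[X,\varepsilon_{2n-6}]=0$, $[X,\eta]=0$; $[Y,\varepsilon_1]=0$, $[Y,\varepsilon_i]=(i-1)(2n-5-i)\varepsilon_{i-1}$ for $2\le i\le 2n-6$, $[Y,\eta]=0$. Let $\mathfrak m$ be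 the negatively graded part of $\mathfrak g$ and $\mathfrak g^0$ the non-negatively graded part (here $\mathfrak g$ is the universal Tanaka prolongation of $\mathfrak m$). Let $C^k(\mathfrak m,\mathfrak g)=\bigwedge^k\mathfrak m^*\otimes\mathfrak g\cong\bigwedge^k(\mathfrak g/\mathfrak g^0)^*\otimes\mathfrak g$, with the $\mathfrak g^0$-action induced by the adjoint action. The subspace $\mathfrak g_{i_1}^*\wedge\dots\wedge\mathfrak g_{i_k}^*\otimes\mathfrak g_{j}$ (all $i_r<0$) has weight $j-\sum_r i_r$, and $C^k_+(\mathfrak m,\mathfrak g)$ is the span of the cochains of positive weight. The coboundary $\partial:C^1(\mathfrak m,\mathfrak g)\to C^2(\mathfrak m,\mathfrak g)$ is $\partial\phi(X,Y)=[X,\phi(Y)]-[Y,\phi(X)]-\phi([X,Y])$; it preserves weight. A linear invariant normalization condition for $\mathfrak g$ is a $\mathfrak g^0$-invariant subspace $\mathcal N\subseteq C^2_+(\mathfrak m,\mathfrak g)$ which is the direct sum of its weight components and satisfies $C^2_+(\mathfrak m,\mathfrak g)=\mathcal N\oplus\partial\big(C^1_+(\mathfrak m,\mathfrak g)\big)$. *)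

theory Defs
  imports "HOL-Analysis.Analysis" "HOL-Analysis.Finite_Function_Topology" "HOL-Library.Function_Algebras"
begin

instantiation "fun" :: (type, real_vector) real_vector
begin

definition scaleR_fun :: "real \<Rightarrow> ('a \<Rightarrow> 'b) \<Rightarrow> 'a \<Rightarrow> 'b"
  where "scaleR_fun c f = (\<lambda>x. c *\<^sub>R f x)"

instance
  by standard (auto simp: scaleR_fun_def fun_eq_iff scaleR_add_left scaleR_add_right)

end


text \<open>
  A finite-dimensional graded real Lie algebra is given by a finite set of homogeneous basis
  elements, their weights, and the brackets of basis elements.  Elements of the algebra are the
  finitely supported functions that are supported on the basis set.  The record itself does not
  enforce the Lie algebra axioms.
\<close>

record 'b graded_lie =
  basis :: "'b set"
  wght :: "'b \<Rightarrow> int"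
  basis_bracket :: "'b \<Rightarrow> 'b \<Rightarrow> ('b \<Rightarrow>\<^sub>0 real)"

definition basis_vec :: "'b \<Rightarrow> ('b \<Rightarrow>\<^sub>0 real)"
  where "basis_vec b = Poly_Mapping.single b 1"

definition lie_space :: "'b graded_lie \<Rightarrow> ('b \<Rightarrow>\<^sub>0 real) set"
  where "lie_space G = span (basis_vec ` basis G)"

definition lie_bracket ::
    "'b graded_lie \<Rightarrow> ('b \<Rightarrow>\<^sub>0 real) \<Rightarrow> ('b \<Rightarrow>\<^sub>0 real) \<Rightarrow> ('b \<Rightarrow>\<^sub>0 real)"
  where "lie_bracket G u v =
    (\<Sum>a\<in>Poly_Mapping.keys u. \<Sum>b\<in>Poly_Mapping.keys v.
       (Poly_Mapping.lookup u a * Poly_Mapping.lookup v b) *\<^sub>R basis_bracket G a b)"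

definition graded_part :: "'b graded_lie \<Rightarrow> int \<Rightarrow> ('b \<Rightarrow>\<^sub>0 real) set"
  where "graded_part G i = span (basis_vec ` {b \<in> basis G. wght G b = i})"

definition nonneg_part :: "'b graded_lie \<Rightarrow> ('b \<Rightarrow>\<^sub>0 real) set"
  where "nonneg_part G = span (\<Union>i\<in>{0..}. graded_part G i)"

text \<open>The projection onto the negative part \<open>\<mm>\<close>; it kills the nonnegative part \<open>\<gg>\<^sup>0\<close>,
  and also all coordinates outside the basis set.\<close>

definition neg_proj :: "'b graded_lie \<Rightarrow> ('b \<Rightarrow>\<^sub>0 real) \<Rightarrow> ('b \<Rightarrow>\<^sub>0 real)"
  where "neg_proj G v =
    (\<Sum>b | b \<in> Poly_Mapping.keys v \<and> b \<in> basis G \<and> wght G b < 0.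
       Poly_Mapping.lookup v b *\<^sub>R basis_vec b)"


text \<open>
  A cochain in \<open>C\<^sup>k(\<mm>, \<gg>) = \<And>\<^sup>k\<mm>\<^sup>* \<otimes> \<gg> \<cong> \<And>\<^sup>k(\<gg>/\<gg>\<^sup>0)\<^sup>* \<otimes> \<gg>\<close> (for \<open>k = 1, 2\<close>) is represented by the
  (alternating multi-)linear map with values in \<open>\<gg>\<close> that factors through the projection to \<open>\<mm>\<close>,
  i.e. vanishes as soon as one argument lies in \<open>\<gg>\<^sup>0\<close>.
\<close>

type_synonym 'b cochain1 = "('b \<Rightarrow>\<^sub>0 real) \<Rightarrow> ('b \<Rightarrow>\<^sub>0 real)"
type_synonym 'b cochain2 = "('b \<Rightarrow>\<^sub>0 real) \<Rightarrow> ('b \<Rightarrow>\<^sub>0 real) \<Rightarrow> ('b \<Rightarrow>\<^sub>0 real)"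

definition cochains1 :: "'b graded_lie \<Rightarrow> 'b cochain1 set"
  where "cochains1 G = {\<phi>. linear \<phi> \<and> (\<forall>x. \<phi> x \<in> lie_space G) \<and> (\<forall>x. \<phi> x = \<phi> (neg_proj G x))}"

definition cochains2 :: "'b graded_lie \<Rightarrow> 'b cochain2 set"
  where "cochains2 G = {\<phi>. bilinear \<phi> \<and> (\<forall>x. \<phi> x x = 0) \<and> (\<forall>x y. \<phi> x y \<in> lie_space G) \<and>
    (\<forall>x y. \<phi> x y = \<phi> (neg_proj G x) (neg_proj G y))}"

text \<open>\<open>\<gg>\<^sub>i\<^sup>* \<otimes> \<gg>\<^sub>j\<close> and \<open>\<gg>\<^sub>i\<^sub>1\<^sup>* \<and> \<gg>\<^sub>i\<^sub>2\<^sup>* \<otimes> \<gg>\<^sub>j\<close>\<close>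

definition cochains1_type :: "'b graded_lie \<Rightarrow> int \<Rightarrow> int \<Rightarrow> 'b cochain1 set"
  where "cochains1_type G i j = {\<phi> \<in> cochains1 G.
    (\<forall>x. \<phi> x \<in> graded_part G j) \<and> (\<forall>a. \<forall>x\<in>graded_part G a. a \<noteq> i \<longrightarrow> \<phi> x = 0)}"

definition cochains2_type :: "'b graded_lie \<Rightarrow> int \<Rightarrow> int \<Rightarrow> int \<Rightarrow> 'b cochain2 set"
  where "cochains2_type G i1 i2 j = {\<phi> \<in> cochains2 G.
    (\<forall>x y. \<phi> x y \<in> graded_part G j) \<and>
    (\<forall>a b. \<forall>x\<in>graded_part G a. \<forall>y\<in>graded_part G b. {a, b} \<noteq> {i1, i2} \<longrightarrow> \<phi> x y = 0)}"

definition cochains1_weight :: "'b graded_lie \<Rightarrow> int \<Rightarrow> 'b cochain1 set"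
  where "cochains1_weight G w = span (\<Union>{cochains1_type G i j | i j. i < 0 \<and> j - i = w})"

definition cochains2_weight :: "'b graded_lie \<Rightarrow> int \<Rightarrow> 'b cochain2 set"
  where "cochains2_weight G w =
    span (\<Union>{cochains2_type G i1 i2 j | i1 i2 j. i1 < 0 \<and> i2 < 0 \<and> j - (i1 + i2) = w})"

definition pos_cochains1 :: "'b graded_lie \<Rightarrow> 'b cochain1 set"
  where "pos_cochains1 G = span (\<Union>w\<in>{0<..}. cochains1_weight G w)"

definition pos_cochains2 :: "'b graded_lie \<Rightarrow> 'b cochain2 set"
  where "pos_cochains2 G = span (\<Union>w\<in>{0<..}. cochains2_weight G w)"

text \<open>The coboundary formula only makes sense on arguments from \<open>\<mm>\<close>, hence the projections.\<close>

definition coboundary1 :: "'b graded_lie \<Rightarrow> 'b cochain1 \<Rightarrow> 'b cochain2"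
  where "coboundary1 G \<phi> = (\<lambda>x y.
    let x' = neg_proj G x; y' = neg_proj G y
    in lie_bracket G x' (\<phi> y') - lie_bracket G y' (\<phi> x') - \<phi> (lie_bracket G x' y'))"

text \<open>The action of \<open>z \<in> \<gg>\<^sup>0\<close> on \<open>\<And>\<^sup>2(\<gg>/\<gg>\<^sup>0)\<^sup>* \<otimes> \<gg>\<close>.  The bracket with \<open>z\<close> is applied to
  \<open>neg_proj G x\<close> only to discard coordinates outside the basis set; for \<open>x \<in> \<gg>\<close> the
  \<open>\<gg>\<^sup>0\<close>-component of \<open>x\<close> contributes nothing, as \<open>\<gg>\<^sup>0\<close> is a subalgebra.\<close>

definition cochain2_action ::
    "'b graded_lie \<Rightarrow> ('b \<Rightarrow>\<^sub>0 real) \<Rightarrow> 'b cochain2 \<Rightarrow> 'b cochain2"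
  where "cochain2_action G z \<phi> = (\<lambda>x y.
    let x' = neg_proj G x; y' = neg_proj G y
    in lie_bracket G z (\<phi> x' y') - \<phi> (lie_bracket G z x') y' - \<phi> x' (lie_bracket G z y'))"

text \<open>Sums of different weight spaces \<open>cochains2_weight G w\<close> are automatically direct, so
  \<open>N\<close> is the direct sum of its weight components iff it is spanned by them.\<close>

definition linear_invariant_normalization_condition :: "'b graded_lie \<Rightarrow> 'b cochain2 set \<Rightarrow> bool"
  where "linear_invariant_normalization_condition G N \<longleftrightarrow>
    subspace N \<and> N \<subseteq> pos_cochains2 G \<and>
    (\<forall>z\<in>nonneg_part G. \<forall>\<phi>\<in>N. cochain2_action G z \<phi> \<in> N) \<and>
    N = span (\<Union>w. N \<inter> cochains2_weight G w) \<and>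
    pos_cochains2 G = {\<phi> + \<psi> | \<phi> \<psi>. \<phi> \<in> N \<and> \<psi> \<in> coboundary1 G ` pos_cochains1 G} \<and>
    N \<inter> coboundary1 G ` pos_cochains1 G = {0}"


datatype gl2_heis_basis = Y | H | E | X | Eps nat | Eta

fun gl2_bracket :: "gl2_heis_basis \<Rightarrow> gl2_heis_basis \<Rightarrow> (gl2_heis_basis \<Rightarrow>\<^sub>0 real)"
  where
    "gl2_bracket X Y = basis_vec H"
  | "gl2_bracket Y X = - basis_vec H"
  | "gl2_bracket H X = 2 *\<^sub>R basis_vec X"
  | "gl2_bracket X H = - (2 *\<^sub>R basis_vec X)"
  | "gl2_bracket H Y = - (2 *\<^sub>R basis_vec Y)"
  | "gl2_bracket Y H = 2 *\<^sub>R basis_vec Y"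
  | "gl2_bracket _ _ = 0"

fun heis_bracket :: "nat \<Rightarrow> gl2_heis_basis \<Rightarrow> gl2_heis_basis \<Rightarrow> (gl2_heis_basis \<Rightarrow>\<^sub>0 real)"
  where
    "heis_bracket n (Eps i) (Eps j) =
       (if 1 \<le> i \<and> i \<le> 2 * n - 6 \<and> j = 2 * n - 5 - i then (- 1) ^ i *\<^sub>R basis_vec Eta else 0)"
  | "heis_bracket n _ _ = 0"

fun gl2_action :: "nat \<Rightarrow> gl2_heis_basis \<Rightarrow> gl2_heis_basis \<Rightarrow> (gl2_heis_basis \<Rightarrow>\<^sub>0 real)"
  where
    "gl2_action n H (Eps i) = (2 * real i + 5 - 2 * real n) *\<^sub>R basis_vec (Eps i)"
  | "gl2_action n E (Eps i) = basis_vec (Eps i)"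
  | "gl2_action n E Eta = 2 *\<^sub>R basis_vec Eta"
  | "gl2_action n X (Eps i) = (if 1 \<le> i \<and> i \<le> 2 * n - 7 then basis_vec (Eps (i + 1)) else 0)"
  | "gl2_action n Y (Eps i) =
       (if 2 \<le> i \<and> i \<le> 2 * n - 6
        then ((real i - 1) * (2 * real n - 5 - real i)) *\<^sub>R basis_vec (Eps (i - 1)) else 0)"
  | "gl2_action n _ _ = 0"

definition gl2_heis :: "nat \<Rightarrow> gl2_heis_basis graded_lie"
  where "gl2_heis n = \<lparr>
    basis = {Y, H, E, X, Eta} \<union> Eps ` {1..2 * n - 6},
    wght = (\<lambda>b. case b of Y \<Rightarrow> 1 | H \<Rightarrow> 0 | E \<Rightarrow> 0 | X \<Rightarrow> - 1 | Eps i \<Rightarrow> - int i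
                       | Eta \<Rightarrow> - 2 * int n + 5),
    basis_bracket = (\<lambda>a b. gl2_bracket a b + heis_bracket n a b
                           + gl2_action n a b - gl2_action n b a)\<rparr>"

end

theory Submission
  imports Defs
begin

text \<open>
  Choose an inner product on \<open>\<gg>\<close> with orthogonal basis \<open>Y, H, E, X, \<epsilon>\<^sub>i, \<eta>\<close> for which \<open>ad X\<close> and
  \<open>ad Y\<close> are adjoint to each other while \<open>ad H\<close> and \<open>ad E\<close> are self-adjoint.  For the induced
  inner product on \<open>C\<^sup>2(\<mm>, \<gg>)\<close>, let \<open>N\<close> consist of the cochains of positive weight orthogonal to all
  coboundaries.  It is a graded complement of the coboundaries of positive weight.  The adjoint
  of the action of \<open>Y\<close> on \<open>C\<^sup>2(\<mm>, \<gg>)\<close> is the action of \<open>X \<in> \<mm>\<close>, which commutes with the coboundary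
  because \<open>\<mm>\<close> is a subalgebra of \<open>\<gg>\<close>; hence \<open>N\<close> is invariant under \<open>Y\<close>.  The same argument with
  self-adjoint actions applies to \<open>H\<close> and \<open>E\<close>.
\<close>

section \<open>Linear algebra\<close>

text \<open>The algebra \<gg> is not reductive, so no inner product can make the adjoint of every
  \<open>ad z\<close> again of the form \<open>ad z'\<close>. Invariance of \<open>N\<close>,
  however, concerns only \<open>\<gg>\<^sup>0\<close>, which is spanned by \<open>Y\<close>,
  \<open>H\<close>, \<open>E\<close> and lies in the gl2 factor. As a module over that factor, \<gg>
  splits into sl2, the line of \<open>E\<close>, the span of the \<open>\<epsilon>\<^sub>i\<close>
  and the line of \<eta>. On each summand the sl2 weight vectors can be rescaled so that
  \<open>X\<close> and \<open>Y\<close> become adjoint, while \<open>H\<close> is diagonal and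
  \<open>E\<close> is a scalar.

  The adjoint \<open>X\<close> of \<open>Y\<close> lies outside \<open>\<gg>\<^sup>0\<close> and
  does not act on the quotient of \<gg> by \<open>\<gg>\<^sup>0\<close>, but it preserves the
  subspace \<mm>. Identifying the quotient with \<mm> through the negative basis elements turns the
  transpose of \<open>Y\<close> on the quotient into \<open>X\<close> on \<mm>. The Jacobi identity
  enters through \<open>X\<close>, \<open>H\<close> and \<open>E\<close>: their \<open>ad\<close>
  must be derivations for their actions to commute with the coboundary.\<close>

lemma scaleR_fun_apply [simp]: "(c *\<^sub>R f) x = c *\<^sub>R f x"
  by (simp add: scaleR_fun_def)

lemma sum_fun_apply: "(sum f A) x = (\<Sum>i\<in>A. f i x)" for f :: "_ \<Rightarrow> _ \<Rightarrow> 'c::comm_monoid_add"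
  by (induction A rule: infinite_finite_induct) auto

section \<open>Coordinates of finitely supported functions\<close>

lemma lookup_scaleR: "Poly_Mapping.lookup (c *\<^sub>R u) k = c * Poly_Mapping.lookup u k"
  for u :: "'b \<Rightarrow>\<^sub>0 real"
proof -
  have "{i. c *\<^sub>R Poly_Mapping.lookup u i \<noteq> 0} \<subseteq> Poly_Mapping.keys u"
    by (auto simp: in_keys_iff)
  then have "finite {i. c *\<^sub>R Poly_Mapping.lookup u i \<noteq> 0}"
    by (rule finite_subset) simp
  then show ?thesis
    by (simp add: scaleR_poly_mapping_def)
qed

lemmas lookup_linear = lookup_add lookup_minus lookup_uminus lookup_scaleR lookup_sum

lemma lookup_basis_vec: "Poly_Mapping.lookup (basis_vec b) k = (if k = b then 1 else 0)"
  by (auto simp: basis_vec_def lookup_single when_def)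

lemma keys_basis_vec [simp]: "Poly_Mapping.keys (basis_vec b) = {b}"
  by (simp add: basis_vec_def)

lemma span_basis_vec_iff:
  "u \<in> span (basis_vec ` A) \<longleftrightarrow> Poly_Mapping.keys u \<subseteq> A"
proof
  assume "u \<in> span (basis_vec ` A)"
  then show "Poly_Mapping.keys u \<subseteq> A"
    by (induction rule: span_induct_alt)
       (auto simp: in_keys_iff lookup_linear lookup_basis_vec split: if_splits)
next
  assume *: "Poly_Mapping.keys u \<subseteq> A"
  have "u = (\<Sum>b\<in>Poly_Mapping.keys u. Poly_Mapping.lookup u b *\<^sub>R basis_vec b)"
    by (rule poly_mapping_eqI)
       (simp add: lookup_linear lookup_basis_vec in_keys_iff if_distrib[of "times _"] cong: if_cong)
  also have "\<dots> \<in> span (basis_vec ` A)"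
    using * by (intro span_sum span_scale span_base) auto
  finally show "u \<in> span (basis_vec ` A)" .
qed

text \<open>Gram-Schmidt along \<open>T\<close>. The form will be \<open>ip2\<close>, which lives on
  a whole function type and is degenerate there, so anisotropy is asked for on \<open>span T\<close>
  alone.\<close>

lemma orthogonal_projection_exists:
  fixes B :: "'v::real_vector \<Rightarrow> 'v \<Rightarrow> real"
  assumes "finite T" and B: "bilinear B" and sym: "\<And>x y. B x y = B y x"
    and "\<And>s. s \<in> span T \<Longrightarrow> B s s = 0 \<Longrightarrow> s = 0"
  shows "\<exists>p\<in>span T. \<forall>t\<in>span T. B (x - p) t = 0"
proof -
  have lin: "B (x - p) t = 0" if "\<forall>t\<in>T. B (x - p) t = 0" "t \<in> span T" for x p t T
    using that(2)
    by (induction rule: span_induct_alt)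
       (auto simp: that(1) bilinear_rzero[OF B] bilinear_radd[OF B] bilinear_rmul[OF B])
  have "\<exists>p\<in>span T. \<forall>t\<in>T. B (x - p) t = 0" for x
    using assms(1,4)
  proof (induction T arbitrary: x rule: finite_induct)
    case empty
    then show ?case by auto
  next
    case (insert t T)
    have sub: "span T \<subseteq> span (insert t T)" by (intro span_mono) auto
    have IH: "\<exists>p\<in>span T. \<forall>t\<in>T. B (x - p) t = 0" for x
      by (rule insert.IH) (use insert.prems sub in blast)
    obtain p where p: "p \<in> span T" "\<forall>s\<in>T. B (x - p) s = 0" using IH by blast
    obtain r where r: "r \<in> span T" "\<forall>s\<in>T. B (t - r) s = 0" using IH by blast
    define u where "u = t - r"
    have u: "u \<in> span (insert t T)"
      unfolding u_def using r sub by (intro span_diff) (auto intro: span_base)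
    show ?case
    proof (cases "B u u = 0")
      case True
      \<comment> \<open>The set \<open>T\<close> may be linearly dependent; in that case the new
        vector \<open>t\<close> adds nothing to the span.\<close>
      then have "u = 0" using insert.prems u by blast
      then have "t \<in> span T" using r by (simp add: u_def)
      then show ?thesis using p lin[OF p(2)] sub by blast
    next
      case False
      \<comment> \<open>The coefficient makes \<open>x - p'\<close> orthogonal to \<open>u\<close>.
        Since \<open>u\<close> is itself orthogonal to \<open>T\<close>, orthogonality to
        \<open>T\<close> survives the correction, and \<open>t = u + r\<close> is covered as
        well.\<close>
      define p' where "p' = p + (B (x - p) u / B u u) *\<^sub>R u"
      have eq: "B (x - p') s = B (x - p) s - (B (x - p) u / B u u) * B u s" for s
        unfolding p'_def diff_diff_eq[symmetric]
        by (simp add: bilinear_lsub[OF B] bilinear_lmul[OF B])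
      have T: "B (x - p') s = 0" if "s \<in> T" for s
        using p r that by (simp add: eq u_def)
      have "t = u + r" by (simp add: u_def)
      then have "B (x - p') t = B (x - p') u + B (x - p') r"
        by (simp add: bilinear_radd[OF B])
      also have "\<dots> = 0"
        using lin[of T x p' r] T r False by (simp add: eq)
      finally have "B (x - p') t = 0" .
      moreover have "p' \<in> span (insert t T)"
        unfolding p'_def using p u sub by (intro span_add span_scale) auto
      ultimately show ?thesis using T by blast
    qed
  qed
  then obtain p where "p \<in> span T" "\<forall>t\<in>T. B (x - p) t = 0" by blast
  then show ?thesis using lin[of T x p] by blast
qed

text \<open>\<open>lie_bracket\<close> sums over the supports of its arguments, and these change
  under addition and scaling. Rewriting the sums over a common finite superset makes them
  comparable, which is how bilinearity is obtained.\<close>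

lemma lie_bracket_superset:
  assumes "finite S" "finite T" "Poly_Mapping.keys u \<subseteq> S" "Poly_Mapping.keys v \<subseteq> T"
  shows "lie_bracket G u v = (\<Sum>a\<in>S. \<Sum>b\<in>T.
    (Poly_Mapping.lookup u a * Poly_Mapping.lookup v b) *\<^sub>R basis_bracket G a b)"
proof -
  have "lie_bracket G u v = (\<Sum>a\<in>Poly_Mapping.keys u. \<Sum>b\<in>T.
    (Poly_Mapping.lookup u a * Poly_Mapping.lookup v b) *\<^sub>R basis_bracket G a b)"
    unfolding lie_bracket_def
    by (intro sum.cong refl sum.mono_neutral_left assms) (auto simp: in_keys_iff)
  also have "\<dots> = (\<Sum>a\<in>S. \<Sum>b\<in>T.
    (Poly_Mapping.lookup u a * Poly_Mapping.lookup v b) *\<^sub>R basis_bracket G a b)"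
    by (intro sum.mono_neutral_left assms) (auto simp: in_keys_iff)
  finally show ?thesis .
qed

lemma bilinear_lie_bracket: "bilinear (lie_bracket G)"
proof -
  define K where "K = (\<lambda>u :: 'a \<Rightarrow>\<^sub>0 real. Poly_Mapping.keys u)"
  have K: "finite (K u)" "Poly_Mapping.keys u = K u" for u by (auto simp: K_def)
  have "lie_bracket G (u + u') v = lie_bracket G u v + lie_bracket G u' v" for u u' v
    by (simp add: lie_bracket_superset[of "K u \<union> K u' \<union> K (u + u')" "K v" _ v G] K
        Un_upper1 le_supI1 lookup_add distrib_right scaleR_add_left sum.distrib)
  moreover have "lie_bracket G u (v + v') = lie_bracket G u v + lie_bracket G u v'" for u v v'
    by (simp add: lie_bracket_superset[of "K u" "K v \<union> K v' \<union> K (v + v')" u _ G] K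
        Un_upper1 le_supI1 lookup_add distrib_left scaleR_add_left sum.distrib)
  moreover have "lie_bracket G (c *\<^sub>R u) v = c *\<^sub>R lie_bracket G u v" for u c v
    by (simp add: lie_bracket_superset[of "K u \<union> K (c *\<^sub>R u)" "K v" _ v G] K
        lookup_scaleR scaleR_sum_right mult.assoc)
  moreover have "lie_bracket G u (c *\<^sub>R v) = c *\<^sub>R lie_bracket G u v" for u c v
    by (simp add: lie_bracket_superset[of "K u" "K v \<union> K (c *\<^sub>R v)" u _ G] K
        lookup_scaleR scaleR_sum_right mult.left_commute)
  ultimately show ?thesis
    by (auto simp: bilinear_def intro!: linearI)
qed

lemmas lie_bracket_simps =
  bilinear_ladd[OF bilinear_lie_bracket] bilinear_radd[OF bilinear_lie_bracket]
  bilinear_lsub[OF bilinear_lie_bracket] bilinear_rsub[OF bilinear_lie_bracket]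
  bilinear_lmul[OF bilinear_lie_bracket] bilinear_rmul[OF bilinear_lie_bracket]
  bilinear_lzero[OF bilinear_lie_bracket] bilinear_rzero[OF bilinear_lie_bracket]
  bilinear_lneg[OF bilinear_lie_bracket] bilinear_rneg[OF bilinear_lie_bracket]

lemma lie_bracket_antisym:
  assumes "\<And>a b. basis_bracket G a b = - basis_bracket G b a"
  shows "lie_bracket G u v = - lie_bracket G v u"
proof -
  have "lie_bracket G u v = (\<Sum>a\<in>Poly_Mapping.keys u. \<Sum>b\<in>Poly_Mapping.keys v.
    - ((Poly_Mapping.lookup v b * Poly_Mapping.lookup u a) *\<^sub>R basis_bracket G b a))"
    unfolding lie_bracket_def using assms
    by (intro sum.cong refl) (metis scaleR_minus_right mult.commute)
  also have "\<dots> = - lie_bracket G v u"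
    unfolding lie_bracket_def sum_negf by (subst sum.swap) simp
  finally show ?thesis .
qed

lemma lie_bracket_basis_vec [simp]:
  "lie_bracket G (basis_vec a) (basis_vec b) = basis_bracket G a b"
  by (simp add: lie_bracket_def lookup_basis_vec)

lemma linear_apply_sum:
  assumes "linear f"
  shows "f (\<Sum>i\<in>A. c i *\<^sub>R g i) = (\<Sum>i\<in>A. c i *\<^sub>R f (g i))"
  by (simp add: linear_sum[OF assms] linear_scale[OF assms])

section \<open>Graded Lie algebras with adjoints\<close>

text \<open>The Jacobi identity with \<open>z\<close> as one entry. The record does not enforce it,
  so it has to be carried as a hypothesis and verified for the concrete algebra.\<close>

definition ad_derivation :: "'b graded_lie \<Rightarrow> 'b \<Rightarrow> bool"
  where "ad_derivation G z \<longleftrightarrow> (\<forall>a\<in>basis G. \<forall>b\<in>basis G.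
    lie_bracket G (basis_vec z) (basis_bracket G a b)
      = lie_bracket G (basis_bracket G z a) (basis_vec b)
        + lie_bracket G (basis_vec a) (basis_bracket G z b))"

text \<open>Matrix form of the relation that pairing [z, a] with b equals pairing a with [z', b],
  for the inner product in which the basis is orthogonal with squared norms
  \<open>q\<close>.\<close>

definition ad_adjoint :: "'b graded_lie \<Rightarrow> ('b \<Rightarrow> real) \<Rightarrow> 'b \<Rightarrow> 'b \<Rightarrow> bool"
  where "ad_adjoint G q z z' \<longleftrightarrow> (\<forall>a\<in>basis G. \<forall>b\<in>basis G.
    q b * Poly_Mapping.lookup (basis_bracket G z a) b
      = q a * Poly_Mapping.lookup (basis_bracket G z' b) a)"

text \<open>The function \<open>q\<close> gives the squared norms of an orthogonal basis.\<close>

locale graded_lie_with_adjoints =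
  fixes G :: "'b graded_lie" and q :: "'b \<Rightarrow> real"
  assumes finite_basis: "finite (basis G)"
    and q_pos: "b \<in> basis G \<Longrightarrow> q b > 0"
    and bracket_graded: "a \<in> basis G \<Longrightarrow> b \<in> basis G \<Longrightarrow>
      Poly_Mapping.keys (basis_bracket G a b) \<subseteq> {k \<in> basis G. wght G k = wght G a + wght G b}"
    and bracket_antisym: "basis_bracket G a b = - basis_bracket G b a"
    and adjoint_ex: "z \<in> basis G \<Longrightarrow> 0 \<le> wght G z \<Longrightarrow>
      \<exists>z'\<in>basis G. wght G z' \<le> 0 \<and> ad_adjoint G q z z' \<and> ad_derivation G z'"
begin

definition neg_basis :: "'b set"
  where "neg_basis = {b \<in> basis G. wght G b < 0}"

lemma finite_neg_basis [simp]: "finite neg_basis"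
  using finite_basis by (simp add: neg_basis_def)

lemma neg_basis_subset: "neg_basis \<subseteq> basis G"
  by (auto simp: neg_basis_def)

lemma lie_space_iff: "u \<in> lie_space G \<longleftrightarrow> Poly_Mapping.keys u \<subseteq> basis G"
  by (simp add: lie_space_def span_basis_vec_iff)

lemma subspace_lie_space: "subspace (lie_space G)"
  by (simp add: lie_space_def)

lemma graded_part_iff:
  "u \<in> graded_part G i \<longleftrightarrow> Poly_Mapping.keys u \<subseteq> {b \<in> basis G. wght G b = i}"
  by (simp add: graded_part_def span_basis_vec_iff)

lemma keys_lie_bracket:
  assumes "k \<in> Poly_Mapping.keys (lie_bracket G u v)"
  obtains a b where "a \<in> Poly_Mapping.keys u" "b \<in> Poly_Mapping.keys v"
    "k \<in> Poly_Mapping.keys (basis_bracket G a b)"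
proof -
  have "\<exists>a\<in>Poly_Mapping.keys u. \<exists>b\<in>Poly_Mapping.keys v. k \<in> Poly_Mapping.keys (basis_bracket G a b)"
  proof (rule ccontr)
    assume "\<not> ?thesis"
    then have "Poly_Mapping.lookup (lie_bracket G u v) k = 0"
      unfolding lie_bracket_def lookup_sum lookup_scaleR
      by (intro sum.neutral ballI) (simp add: in_keys_iff)
    with assms show False by (simp add: in_keys_iff)
  qed
  with that show ?thesis by blast
qed

lemma lie_bracket_in_lie_space:
  "u \<in> lie_space G \<Longrightarrow> v \<in> lie_space G \<Longrightarrow> lie_bracket G u v \<in> lie_space G"
  unfolding lie_space_iff using bracket_graded by (blast elim: keys_lie_bracket)

lemma lookup_neg_proj:
  "Poly_Mapping.lookup (neg_proj G x) k = (if k \<in> neg_basis then Poly_Mapping.lookup x k else 0)"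
proof -
  have "finite {b \<in> Poly_Mapping.keys x. b \<in> basis G \<and> wght G b < 0}" by simp
  then show ?thesis
    by (auto simp: neg_proj_def lookup_linear lookup_basis_vec neg_basis_def in_keys_iff
        if_distrib[of "times _"] cong: if_cong)
qed

lemma neg_proj_expand: "neg_proj G x = (\<Sum>a\<in>neg_basis. Poly_Mapping.lookup x a *\<^sub>R basis_vec a)"
  by (rule poly_mapping_eqI)
     (simp add: lookup_neg_proj lookup_linear lookup_basis_vec if_distrib[of "times _"] cong: if_cong)

lemma linear_neg_proj: "linear (neg_proj G)"
  by (intro linearI poly_mapping_eqI) (auto simp: lookup_neg_proj lookup_linear)

lemma keys_neg_proj: "Poly_Mapping.keys (neg_proj G x) \<subseteq> neg_basis"
  by (auto simp: in_keys_iff lookup_neg_proj split: if_splits)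

lemma neg_proj_in_lie_space [simp]: "neg_proj G x \<in> lie_space G"
  using keys_neg_proj neg_basis_subset by (auto simp: lie_space_iff)

lemma neg_proj_id: "Poly_Mapping.keys x \<subseteq> neg_basis \<Longrightarrow> neg_proj G x = x"
  by (rule poly_mapping_eqI) (auto simp: lookup_neg_proj in_keys_iff)

lemma neg_proj_idem [simp]: "neg_proj G (neg_proj G x) = neg_proj G x"
  by (intro neg_proj_id keys_neg_proj)

lemma neg_proj_basis_vec [simp]: "a \<in> neg_basis \<Longrightarrow> neg_proj G (basis_vec a) = basis_vec a"
  by (simp add: neg_proj_id)

lemma basis_vec_in_lie_space [simp]: "a \<in> basis G \<Longrightarrow> basis_vec a \<in> lie_space G"
  by (simp add: lie_space_iff)

lemma neg_basis_in_basis: "a \<in> neg_basis \<Longrightarrow> a \<in> basis G"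
  by (simp add: neg_basis_def)

lemma keys_bracket_neg_basis:
  assumes "z \<in> basis G" "wght G z \<le> 0" "Poly_Mapping.keys x \<subseteq> neg_basis"
  shows "Poly_Mapping.keys (lie_bracket G (basis_vec z) x) \<subseteq> neg_basis"
proof
  fix k assume "k \<in> Poly_Mapping.keys (lie_bracket G (basis_vec z) x)"
  then obtain a b where "a \<in> Poly_Mapping.keys (basis_vec z)" "b \<in> Poly_Mapping.keys x"
    "k \<in> Poly_Mapping.keys (basis_bracket G a b)"
    by (rule keys_lie_bracket)
  then have b: "b \<in> Poly_Mapping.keys x" "k \<in> Poly_Mapping.keys (basis_bracket G z b)"
    by simp_all
  have "b \<in> basis G" "wght G b < 0"
    using b assms(3) by (auto simp: neg_basis_def)
  then show "k \<in> neg_basis"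
    using b(2) bracket_graded[of z b] assms(1,2) by (auto simp: neg_basis_def)
qed

lemma keys_lie_bracket_neg_basis:
  assumes "Poly_Mapping.keys x \<subseteq> neg_basis" "Poly_Mapping.keys y \<subseteq> neg_basis"
  shows "Poly_Mapping.keys (lie_bracket G x y) \<subseteq> neg_basis"
proof
  fix k assume "k \<in> Poly_Mapping.keys (lie_bracket G x y)"
  then obtain a b where ab: "a \<in> Poly_Mapping.keys x" "b \<in> Poly_Mapping.keys y"
    "k \<in> Poly_Mapping.keys (basis_bracket G a b)"
    by (rule keys_lie_bracket)
  moreover have "a \<in> basis G" "wght G a < 0" "b \<in> basis G" "wght G b < 0"
    using ab assms by (auto simp: neg_basis_def)
  ultimately show "k \<in> neg_basis"
    using bracket_graded[of a b] by (auto simp: neg_basis_def)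
qed

lemma lie_bracket_self: "lie_bracket G u u = 0"
proof (rule poly_mapping_eqI)
  fix k
  have "Poly_Mapping.lookup (lie_bracket G u u) k = - Poly_Mapping.lookup (lie_bracket G u u) k"
    using lie_bracket_antisym[OF bracket_antisym, of u u] by (metis lookup_uminus)
  then show "Poly_Mapping.lookup (lie_bracket G u u) k = Poly_Mapping.lookup 0 k" by simp
qed

subsection \<open>Cochains in coordinates\<close>

lemma cochains1_expand:
  assumes "\<phi> \<in> cochains1 G"
  shows "\<phi> x = (\<Sum>a\<in>neg_basis. Poly_Mapping.lookup x a *\<^sub>R \<phi> (basis_vec a))"
proof -
  have lin: "linear \<phi>" and "\<phi> x = \<phi> (neg_proj G x)"
    using assms unfolding cochains1_def by blast+
  then have "\<phi> x = \<phi> (\<Sum>a\<in>neg_basis. Poly_Mapping.lookup x a *\<^sub>R basis_vec a)"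
    by (simp only: neg_proj_expand[symmetric])
  then show ?thesis
    by (simp only: linear_apply_sum[OF lin])
qed

lemma cochains2_expand:
  assumes "\<phi> \<in> cochains2 G"
  shows "\<phi> x y = (\<Sum>a\<in>neg_basis. \<Sum>b\<in>neg_basis.
    (Poly_Mapping.lookup x a * Poly_Mapping.lookup y b) *\<^sub>R \<phi> (basis_vec a) (basis_vec b))"
proof -
  have bil: "bilinear \<phi>" and "\<phi> x y = \<phi> (neg_proj G x) (neg_proj G y)"
    using assms unfolding cochains2_def by blast+
  then have "\<phi> x y = \<phi> (\<Sum>a\<in>neg_basis. Poly_Mapping.lookup x a *\<^sub>R basis_vec a)
     (\<Sum>a\<in>neg_basis. Poly_Mapping.lookup y a *\<^sub>R basis_vec a)"
    by (simp only: neg_proj_expand[symmetric])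
  also have "\<dots> = (\<Sum>(a, b)\<in>neg_basis \<times> neg_basis. \<phi> (Poly_Mapping.lookup x a *\<^sub>R basis_vec a)
     (Poly_Mapping.lookup y b *\<^sub>R basis_vec b))"
    by (rule bilinear_sum[OF bil])
  finally show ?thesis
    by (simp only: sum.cartesian_product bilinear_lmul[OF bil] bilinear_rmul[OF bil] scaleR_scaleR
        mult.commute)
qed

lemma cochains1_eqI:
  assumes "\<phi> \<in> cochains1 G" "\<psi> \<in> cochains1 G"
    and "\<And>a. a \<in> neg_basis \<Longrightarrow> \<phi> (basis_vec a) = \<psi> (basis_vec a)"
  shows "\<phi> = \<psi>"
proof
  fix x
  show "\<phi> x = \<psi> x"
    unfolding cochains1_expand[OF assms(1), of x] cochains1_expand[OF assms(2), of x]
    using assms(3) by simp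
qed

lemma cochains2_eqI:
  assumes "\<phi> \<in> cochains2 G" "\<psi> \<in> cochains2 G"
    and "\<And>a b. a \<in> neg_basis \<Longrightarrow> b \<in> neg_basis \<Longrightarrow>
      \<phi> (basis_vec a) (basis_vec b) = \<psi> (basis_vec a) (basis_vec b)"
  shows "\<phi> = \<psi>"
proof (intro ext)
  fix x y
  show "\<phi> x y = \<psi> x y"
    unfolding cochains2_expand[OF assms(1), of x y] cochains2_expand[OF assms(2), of x y]
    using assms(3) by simp
qed

lemma subspace_cochains1: "subspace (cochains1 G)"
proof (rule subspaceI)
  show "0 \<in> cochains1 G"
    using subspace_0[OF subspace_lie_space]
    by (auto simp: cochains1_def zero_fun_def linear_zero)
  show "\<phi> + \<psi> \<in> cochains1 G" if "\<phi> \<in> cochains1 G" "\<psi> \<in> cochains1 G" for \<phi> \<psi>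
  proof -
    have *: "linear \<phi>" "linear \<psi>" "\<phi> x = \<phi> (neg_proj G x)" "\<psi> x = \<psi> (neg_proj G x)"
      "\<phi> x \<in> lie_space G" "\<psi> x \<in> lie_space G" for x
      using that unfolding cochains1_def by blast+
    have "linear (\<phi> + \<psi>)"
      using linear_compose_add[OF *(1,2)] by (simp add: plus_fun_def)
    moreover have "(\<phi> + \<psi>) x = (\<phi> + \<psi>) (neg_proj G x)" for x
      using *(3,4)[of x] by simp
    moreover have "(\<phi> + \<psi>) x \<in> lie_space G" for x
      using subspace_add[OF subspace_lie_space *(5,6)] by simp
    ultimately show ?thesis unfolding cochains1_def by blast
  qed
  show "c *\<^sub>R \<phi> \<in> cochains1 G" if "\<phi> \<in> cochains1 G" for c \<phi>
  proof -
    have *: "linear \<phi>" "\<phi> x = \<phi> (neg_proj G x)" "\<phi> x \<in> lie_space G" for x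
      using that unfolding cochains1_def by blast+
    have "linear (c *\<^sub>R \<phi>)"
      using linear_compose_scale_right[OF *(1), of c] by (simp add: scaleR_fun_def)
    moreover have "(c *\<^sub>R \<phi>) x = (c *\<^sub>R \<phi>) (neg_proj G x)" for x
      using *(2)[of x] by simp
    moreover have "(c *\<^sub>R \<phi>) x \<in> lie_space G" for x
      using subspace_scale[OF subspace_lie_space *(3)] by simp
    ultimately show ?thesis unfolding cochains1_def by blast
  qed
qed

lemma subspace_cochains2: "subspace (cochains2 G)"
proof (rule subspaceI)
  show "0 \<in> cochains2 G"
    using subspace_0[OF subspace_lie_space]
    by (auto simp: cochains2_def zero_fun_def linear_zero bilinear_def)
  show "\<phi> + \<psi> \<in> cochains2 G" if "\<phi> \<in> cochains2 G" "\<psi> \<in> cochains2 G" for \<phi> \<psi>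
  proof -
    have *: "bilinear \<phi>" "bilinear \<psi>" "\<phi> x y = \<phi> (neg_proj G x) (neg_proj G y)"
      "\<psi> x y = \<psi> (neg_proj G x) (neg_proj G y)"
      "\<phi> x y \<in> lie_space G" "\<psi> x y \<in> lie_space G" "\<phi> x x = 0" "\<psi> x x = 0" for x y
      using that unfolding cochains2_def by blast+
    have "bilinear (\<phi> + \<psi>)"
      using *(1,2) by (auto simp: bilinear_def intro!: linear_compose_add)
    moreover have "(\<phi> + \<psi>) x y = (\<phi> + \<psi>) (neg_proj G x) (neg_proj G y)" for x y
      using *(3,4)[of x y] by simp
    moreover have "(\<phi> + \<psi>) x y \<in> lie_space G" for x y
      using subspace_add[OF subspace_lie_space *(5,6)] by simp
    moreover have "(\<phi> + \<psi>) x x = 0" for x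
      using *(7,8) by simp
    ultimately show ?thesis unfolding cochains2_def by blast
  qed
  show "c *\<^sub>R \<phi> \<in> cochains2 G" if "\<phi> \<in> cochains2 G" for c \<phi>
  proof -
    have *: "bilinear \<phi>" "\<phi> x y = \<phi> (neg_proj G x) (neg_proj G y)"
      "\<phi> x y \<in> lie_space G" "\<phi> x x = 0" for x y
      using that unfolding cochains2_def by blast+
    have "bilinear (c *\<^sub>R \<phi>)"
      using *(1) by (auto simp: bilinear_def intro!: linear_compose_scale_right)
    moreover have "(c *\<^sub>R \<phi>) x y = (c *\<^sub>R \<phi>) (neg_proj G x) (neg_proj G y)" for x y
      using *(2)[of x y] by simp
    moreover have "(c *\<^sub>R \<phi>) x y \<in> lie_space G" for x y
      using subspace_scale[OF subspace_lie_space *(3)] by simp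
    moreover have "(c *\<^sub>R \<phi>) x x = 0" for x
      using *(4) by simp
    ultimately show ?thesis unfolding cochains2_def by blast
  qed
qed

lemma cochains2_antisym:
  assumes "\<phi> \<in> cochains2 G"
  shows "\<phi> x y = - \<phi> y x"
proof -
  have bil: "bilinear \<phi>" and 0: "\<phi> x x = 0" for x
    using assms unfolding cochains2_def by blast+
  have "\<phi> (x + y) (x + y) = \<phi> x y + \<phi> y x"
    by (simp only: bilinear_ladd[OF bil] bilinear_radd[OF bil] 0[of x] 0[of y]) simp
  then show ?thesis
    using 0[of "x + y"] by (simp add: eq_neg_iff_add_eq_0)
qed

subsection \<open>Weights\<close>

text \<open>A set \<open>W\<close> of admissible weights, instead of a single weight, lets the same
  lemmas treat one weight component, all positive weights and the complement
  \<open>- W\<close>.\<close>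

definition weights1_in :: "int set \<Rightarrow> 'b cochain1 set"
  where "weights1_in W = {\<phi> \<in> cochains1 G. \<forall>a\<in>neg_basis. \<forall>k.
    Poly_Mapping.lookup (\<phi> (basis_vec a)) k \<noteq> 0 \<longrightarrow> wght G k - wght G a \<in> W}"

definition weights2_in :: "int set \<Rightarrow> 'b cochain2 set"
  where "weights2_in W = {\<phi> \<in> cochains2 G. \<forall>a\<in>neg_basis. \<forall>b\<in>neg_basis. \<forall>k.
    Poly_Mapping.lookup (\<phi> (basis_vec a) (basis_vec b)) k \<noteq> 0
      \<longrightarrow> wght G k - (wght G a + wght G b) \<in> W}"

definition elem1 :: "'b \<Rightarrow> 'b \<Rightarrow> 'b cochain1"
  where "elem1 a k = (\<lambda>x. Poly_Mapping.lookup x a *\<^sub>R basis_vec k)"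

text \<open>The elementary cochain formed from the wedge of the dual vectors of \<open>a\<close> and
  \<open>b\<close>, tensored with \<open>k\<close>. It vanishes for \<open>a = b\<close> and changes
  sign when \<open>a\<close> and \<open>b\<close> are exchanged.\<close>

definition elem2 :: "'b \<Rightarrow> 'b \<Rightarrow> 'b \<Rightarrow> 'b cochain2"
  where "elem2 a b k = (\<lambda>x y. (Poly_Mapping.lookup x a * Poly_Mapping.lookup y b
    - Poly_Mapping.lookup x b * Poly_Mapping.lookup y a) *\<^sub>R basis_vec k)"

definition index1 :: "int set \<Rightarrow> ('b \<times> 'b) set"
  where "index1 W = {(a, k) \<in> neg_basis \<times> basis G. wght G k - wght G a \<in> W}"

text \<open>Both orders of a pair are indexed, and the diagonal too: the basis type carries no
  linear order by which to select one of \<open>(a, b)\<close> and \<open>(b, a)\<close>.\<close>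

definition index2 :: "int set \<Rightarrow> ('b \<times> 'b \<times> 'b) set"
  where "index2 W = {(a, b, k) \<in> neg_basis \<times> neg_basis \<times> basis G.
    wght G k - (wght G a + wght G b) \<in> W}"

definition part1 :: "int set \<Rightarrow> 'b cochain1 \<Rightarrow> 'b cochain1"
  where "part1 W \<phi> = (\<Sum>(a, k)\<in>index1 W. Poly_Mapping.lookup (\<phi> (basis_vec a)) k *\<^sub>R elem1 a k)"

text \<open>The division by 2 below accounts for each coordinate occurring twice, with opposite signs.\<close>

definition part2 :: "int set \<Rightarrow> 'b cochain2 \<Rightarrow> 'b cochain2"
  where "part2 W \<phi> = (\<Sum>(a, b, k)\<in>index2 W.
    (Poly_Mapping.lookup (\<phi> (basis_vec a) (basis_vec b)) k / 2) *\<^sub>R elem2 a b k)"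

lemma finite_index1 [simp]: "finite (index1 W)"
  by (rule finite_subset[of _ "neg_basis \<times> basis G"]) (auto simp: index1_def finite_basis)

lemma finite_index2 [simp]: "finite (index2 W)"
  by (rule finite_subset[of _ "neg_basis \<times> neg_basis \<times> basis G"])
     (auto simp: index2_def finite_basis)

lemma subspace_weights1_in: "subspace (weights1_in W)"
proof (rule subspaceI)
  show "0 \<in> weights1_in W"
    using subspace_0[OF subspace_cochains1] by (simp add: weights1_in_def)
  show "\<phi> + \<psi> \<in> weights1_in W" if *: "\<phi> \<in> weights1_in W" "\<psi> \<in> weights1_in W" for \<phi> \<psi>
    unfolding weights1_in_def
  proof (intro CollectI conjI ballI allI impI)
    show "\<phi> + \<psi> \<in> cochains1 G"
      using * by (intro subspace_add[OF subspace_cochains1]) (auto simp: weights1_in_def)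
    fix a k assume a: "a \<in> neg_basis" "Poly_Mapping.lookup ((\<phi> + \<psi>) (basis_vec a)) k \<noteq> 0"
    then have "Poly_Mapping.lookup (\<phi> (basis_vec a)) k \<noteq> 0 \<or>
      Poly_Mapping.lookup (\<psi> (basis_vec a)) k \<noteq> 0" by (auto simp: lookup_linear)
    with * a(1) show "wght G k - wght G a \<in> W" unfolding weights1_in_def by blast
  qed
  show "c *\<^sub>R \<phi> \<in> weights1_in W" if *: "\<phi> \<in> weights1_in W" for c \<phi>
    using that subspace_scale[OF subspace_cochains1, of \<phi> c]
    by (auto simp: weights1_in_def lookup_linear)
qed

lemma subspace_weights2_in: "subspace (weights2_in W)"
proof (rule subspaceI)
  show "0 \<in> weights2_in W"
    using subspace_0[OF subspace_cochains2] by (simp add: weights2_in_def)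
  show "\<phi> + \<psi> \<in> weights2_in W" if *: "\<phi> \<in> weights2_in W" "\<psi> \<in> weights2_in W" for \<phi> \<psi>
    unfolding weights2_in_def
  proof (intro CollectI conjI ballI allI impI)
    show "\<phi> + \<psi> \<in> cochains2 G"
      using * by (intro subspace_add[OF subspace_cochains2]) (auto simp: weights2_in_def)
    fix a b k assume a: "a \<in> neg_basis" "b \<in> neg_basis"
      "Poly_Mapping.lookup ((\<phi> + \<psi>) (basis_vec a) (basis_vec b)) k \<noteq> 0"
    then have "Poly_Mapping.lookup (\<phi> (basis_vec a) (basis_vec b)) k \<noteq> 0 \<or>
      Poly_Mapping.lookup (\<psi> (basis_vec a) (basis_vec b)) k \<noteq> 0" by (auto simp: lookup_linear)
    with * a(1,2) show "wght G k - (wght G a + wght G b) \<in> W" unfolding weights2_in_def by blast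
  qed
  show "c *\<^sub>R \<phi> \<in> weights2_in W" if *: "\<phi> \<in> weights2_in W" for c \<phi>
    using that subspace_scale[OF subspace_cochains2, of \<phi> c]
    by (auto simp: weights2_in_def lookup_linear)
qed

lemma elem1_in_type:
  assumes "a \<in> neg_basis" "k \<in> basis G"
  shows "elem1 a k \<in> cochains1_type G (wght G a) (wght G k)"
proof -
  have "linear (elem1 a k)"
    by (rule linearI) (simp_all add: elem1_def lookup_linear scaleR_add_left)
  moreover have "elem1 a k x \<in> lie_space G" for x
    using assms subspace_scale[OF subspace_lie_space] by (simp add: elem1_def)
  moreover have "elem1 a k x = elem1 a k (neg_proj G x)" for x
    using assms by (simp add: elem1_def lookup_neg_proj)
  moreover have "elem1 a k x \<in> graded_part G (wght G k)" for x
    using assms by (auto simp: elem1_def graded_part_iff in_keys_iff lookup_linear lookup_basis_vec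
        split: if_splits)
  moreover have "elem1 a k x = 0" if "x \<in> graded_part G i" "i \<noteq> wght G a" for i x
    using that by (auto simp: elem1_def graded_part_iff in_keys_iff)
  ultimately show ?thesis
    by (auto simp: cochains1_type_def cochains1_def)
qed

lemma elem2_in_type:
  assumes "a \<in> neg_basis" "b \<in> neg_basis" "k \<in> basis G"
  shows "elem2 a b k \<in> cochains2_type G (wght G a) (wght G b) (wght G k)"
proof -
  have "bilinear (elem2 a b k)"
    unfolding bilinear_def by (intro conjI allI linearI)
      (simp_all add: elem2_def lookup_linear algebra_simps)
  moreover have "elem2 a b k x y \<in> lie_space G" for x y
    using assms subspace_scale[OF subspace_lie_space] by (simp add: elem2_def)
  moreover have "elem2 a b k x y = elem2 a b k (neg_proj G x) (neg_proj G y)" for x y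
    using assms by (simp add: elem2_def lookup_neg_proj)
  moreover have "elem2 a b k x x = 0" for x
    by (simp add: elem2_def)
  moreover have "elem2 a b k x y \<in> graded_part G (wght G k)" for x y
    using assms by (auto simp: elem2_def graded_part_iff in_keys_iff lookup_linear lookup_basis_vec
        split: if_splits)
  moreover have "elem2 a b k x y = 0"
    if "x \<in> graded_part G i" "y \<in> graded_part G j" "{i, j} \<noteq> {wght G a, wght G b}" for i j x y
  proof -
    \<comment> \<open>A homogeneous vector has nonzero coordinates only at basis elements of its own
      degree. If either product below were nonzero, the degrees of \<open>x\<close> and
      \<open>y\<close> would be those of \<open>a\<close> and \<open>b\<close> in some
      order.\<close>
    have "Poly_Mapping.lookup x c \<noteq> 0 \<Longrightarrow> i = wght G c"
      "Poly_Mapping.lookup y c \<noteq> 0 \<Longrightarrow> j = wght G c" for c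
      using that by (auto simp: graded_part_iff in_keys_iff)
    then have "Poly_Mapping.lookup x a * Poly_Mapping.lookup y b = 0"
      "Poly_Mapping.lookup x b * Poly_Mapping.lookup y a = 0"
      using that(3) by (metis insert_commute mult_eq_0_iff)+
    then show ?thesis by (auto simp: elem2_def)
  qed
  ultimately show ?thesis
    unfolding cochains2_type_def cochains2_def by blast
qed

lemma cochains1_type_subset: "cochains1_type G i j \<subseteq> weights1_in {j - i}"
proof
  fix \<phi> assume \<phi>: "\<phi> \<in> cochains1_type G i j"
  have "wght G k - wght G a = j - i"
    if "a \<in> neg_basis" "Poly_Mapping.lookup (\<phi> (basis_vec a)) k \<noteq> 0" for a k
  proof -
    have "basis_vec a \<in> graded_part G (wght G a)"
      using that by (simp add: graded_part_iff neg_basis_in_basis)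
    moreover have "\<phi> (basis_vec a) \<noteq> 0" using that by auto
    ultimately have "wght G a = i" using \<phi> unfolding cochains1_type_def by blast
    moreover have "\<phi> (basis_vec a) \<in> graded_part G j"
      using \<phi> by (simp add: cochains1_type_def)
    then have "wght G k = j"
      using that by (auto simp: graded_part_iff in_keys_iff)
    ultimately show ?thesis by simp
  qed
  with \<phi> show "\<phi> \<in> weights1_in {j - i}"
    by (simp add: weights1_in_def cochains1_type_def)
qed

lemma cochains2_type_subset: "cochains2_type G i1 i2 j \<subseteq> weights2_in {j - (i1 + i2)}"
proof
  fix \<phi> assume \<phi>: "\<phi> \<in> cochains2_type G i1 i2 j"
  have "wght G k - (wght G a + wght G b) = j - (i1 + i2)"
    if "a \<in> neg_basis" "b \<in> neg_basis"
      "Poly_Mapping.lookup (\<phi> (basis_vec a) (basis_vec b)) k \<noteq> 0" for a b k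
  proof -
    have "basis_vec a \<in> graded_part G (wght G a)" "basis_vec b \<in> graded_part G (wght G b)"
      using that by (simp_all add: graded_part_iff neg_basis_in_basis)
    moreover have "\<phi> (basis_vec a) (basis_vec b) \<noteq> 0" using that by auto
    ultimately have "{wght G a, wght G b} = {i1, i2}" using \<phi> unfolding cochains2_type_def by blast
    then have "wght G a + wght G b = i1 + i2" by (auto simp: doubleton_eq_iff)
    moreover have "\<phi> (basis_vec a) (basis_vec b) \<in> graded_part G j"
      using \<phi> by (simp add: cochains2_type_def)
    then have "wght G k = j"
      using that by (auto simp: graded_part_iff in_keys_iff)
    ultimately show ?thesis by simp
  qed
  with \<phi> show "\<phi> \<in> weights2_in {j - (i1 + i2)}"
    by (simp add: weights2_in_def cochains2_type_def)
qed

lemma weights1_in_mono: "V \<subseteq> W \<Longrightarrow> weights1_in V \<subseteq> weights1_in W"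
  unfolding weights1_in_def by blast

lemma weights2_in_mono: "V \<subseteq> W \<Longrightarrow> weights2_in V \<subseteq> weights2_in W"
  unfolding weights2_in_def by blast

lemma elem1_in_weights: "(a, k) \<in> index1 W \<Longrightarrow> elem1 a k \<in> weights1_in W"
  using elem1_in_type[of a k] cochains1_type_subset weights1_in_mono[of "{wght G k - wght G a}" W]
  by (fastforce simp: index1_def)

lemma elem2_in_weights: "(a, b, k) \<in> index2 W \<Longrightarrow> elem2 a b k \<in> weights2_in W"
  using elem2_in_type[of a b k] cochains2_type_subset
    weights2_in_mono[of "{wght G k - (wght G a + wght G b)}" W]
  by (fastforce simp: index2_def)

lemma part1_in_weights: "part1 W \<phi> \<in> weights1_in W"
  unfolding part1_def
  by (intro subspace_sum[OF subspace_weights1_in])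
     (auto intro!: subspace_scale[OF subspace_weights1_in] elem1_in_weights)

lemma part2_in_weights: "part2 W \<phi> \<in> weights2_in W"
  unfolding part2_def
  by (intro subspace_sum[OF subspace_weights2_in])
     (auto intro!: subspace_scale[OF subspace_weights2_in] elem2_in_weights)

lemma lookup_part1:
  assumes "a \<in> neg_basis"
  shows "Poly_Mapping.lookup (part1 W \<phi> (basis_vec a)) k
    = (if (a, k) \<in> index1 W then Poly_Mapping.lookup (\<phi> (basis_vec a)) k else 0)"
proof -
  have "Poly_Mapping.lookup (part1 W \<phi> (basis_vec a)) k
    = (\<Sum>p\<in>index1 W. if p = (a, k) then Poly_Mapping.lookup (\<phi> (basis_vec a)) k else 0)"
    unfolding part1_def sum_fun_apply lookup_sum
    by (intro sum.cong refl) (auto simp: elem1_def lookup_linear lookup_basis_vec split: if_splits)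
  then show ?thesis by simp
qed

lemma index2_swap: "(a, b, k) \<in> index2 W \<longleftrightarrow> (b, a, k) \<in> index2 W"
  by (simp add: index2_def add.commute[of "wght G a"] conj_left_commute)

lemma lookup_elem2:
  "Poly_Mapping.lookup (elem2 a b k (basis_vec a') (basis_vec b')) k'
    = (if (a, b, k) = (a', b', k') then 1 else 0) - (if (a, b, k) = (b', a', k') then 1 else 0)"
  by (cases "a = a'"; cases "b = b'"; cases "a = b'"; cases "b = a'"; cases "k = k'")
     (simp_all add: elem2_def lookup_scaleR lookup_basis_vec)

lemma lookup_part2:
  assumes "a \<in> neg_basis" "b \<in> neg_basis" "\<phi> \<in> cochains2 G"
  shows "Poly_Mapping.lookup (part2 W \<phi> (basis_vec a) (basis_vec b)) k
    = (if (a, b, k) \<in> index2 W then Poly_Mapping.lookup (\<phi> (basis_vec a) (basis_vec b)) k else 0)"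
proof -
  let ?c' = "\<lambda>a b. Poly_Mapping.lookup (\<phi> (basis_vec a) (basis_vec b))"
  let ?c = "\<lambda>a b. ?c' a b k"
  have "Poly_Mapping.lookup (part2 W \<phi> (basis_vec a) (basis_vec b)) k
    = (\<Sum>p\<in>index2 W. (if p = (a, b, k) then ?c a b / 2 else 0)
         - (if p = (b, a, k) then ?c b a / 2 else 0))"
    unfolding part2_def sum_fun_apply lookup_sum
  proof (intro sum.cong refl, clarify)
    fix a' b' k'
    show "Poly_Mapping.lookup (((?c' a' b' k' / 2) *\<^sub>R elem2 a' b' k') (basis_vec a) (basis_vec b)) k
      = (if (a', b', k') = (a, b, k) then ?c a b / 2 else 0)
         - (if (a', b', k') = (b, a, k) then ?c b a / 2 else 0)"
      unfolding scaleR_fun_apply lookup_scaleR lookup_elem2 right_diff_distrib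
      by (rule arg_cong2[where f = "(-)"]) auto
  qed
  also have "\<dots> = (if (a, b, k) \<in> index2 W then ?c a b / 2 - ?c b a / 2 else 0)"
    by (simp add: sum_subtractf index2_swap[of b a])
  \<comment> \<open>By antisymmetry the two half coordinates add up to the full one; for
    \<open>a = b\<close> both are zero.\<close>
  also have "?c b a = - ?c a b"
    using cochains2_antisym[OF assms(3), of "basis_vec b" "basis_vec a"] by simp
  finally show ?thesis by simp
qed

lemma lookup_cochain1_eq_0:
  "\<phi> \<in> cochains1 G \<Longrightarrow> k \<notin> basis G \<Longrightarrow> Poly_Mapping.lookup (\<phi> x) k = 0"
  unfolding cochains1_def lie_space_iff by (blast intro: not_in_keys_iff_lookup_eq_zero[THEN iffD1])

lemma lookup_cochain2_eq_0:
  "\<phi> \<in> cochains2 G \<Longrightarrow> k \<notin> basis G \<Longrightarrow> Poly_Mapping.lookup (\<phi> x y) k = 0"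
  unfolding cochains2_def lie_space_iff by (blast intro: not_in_keys_iff_lookup_eq_zero[THEN iffD1])

lemma weights1_in_cochains1: "weights1_in W \<subseteq> cochains1 G"
  by (auto simp: weights1_in_def)

lemma weights2_in_cochains2: "weights2_in W \<subseteq> cochains2 G"
  by (auto simp: weights2_in_def)

lemma diff_part1_in_weights:
  assumes "\<phi> \<in> cochains1 G"
  shows "\<phi> - part1 W \<phi> \<in> weights1_in (- W)"
proof -
  have "\<phi> - part1 W \<phi> \<in> cochains1 G"
    using assms part1_in_weights weights1_in_cochains1 by (blast intro: subspace_diff[OF subspace_cochains1])
  then show ?thesis
    using lookup_cochain1_eq_0[OF assms]
    by (auto simp: weights1_in_def lookup_linear lookup_part1 index1_def split: if_splits)
qed

lemma diff_part2_in_weights: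
  assumes "\<phi> \<in> cochains2 G"
  shows "\<phi> - part2 W \<phi> \<in> weights2_in (- W)"
proof -
  have "\<phi> - part2 W \<phi> \<in> cochains2 G"
    using assms part2_in_weights weights2_in_cochains2 by (blast intro: subspace_diff[OF subspace_cochains2])
  then show ?thesis
    using lookup_cochain2_eq_0[OF assms]
    by (auto simp: weights2_in_def lookup_linear lookup_part2[OF _ _ assms] index2_def split: if_splits)
qed

lemma part1_eq:
  assumes "\<phi> \<in> weights1_in W"
  shows "part1 W \<phi> = \<phi>"
proof (rule cochains1_eqI)
  show "part1 W \<phi> \<in> cochains1 G" "\<phi> \<in> cochains1 G"
    using assms part1_in_weights weights1_in_cochains1 by blast+
  then show "part1 W \<phi> (basis_vec a) = \<phi> (basis_vec a)" if "a \<in> neg_basis" for a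
    using that assms lookup_cochain1_eq_0[of \<phi>]
    by (intro poly_mapping_eqI) (auto simp: lookup_part1 index1_def weights1_in_def)
qed

lemma part2_eq:
  assumes "\<phi> \<in> weights2_in W"
  shows "part2 W \<phi> = \<phi>"
proof (rule cochains2_eqI)
  show "part2 W \<phi> \<in> cochains2 G" and \<phi>: "\<phi> \<in> cochains2 G"
    using assms part2_in_weights weights2_in_cochains2 by blast+
  then show "part2 W \<phi> (basis_vec a) (basis_vec b) = \<phi> (basis_vec a) (basis_vec b)"
    if "a \<in> neg_basis" "b \<in> neg_basis" for a b
    using that assms lookup_cochain2_eq_0[of \<phi>]
    by (intro poly_mapping_eqI) (auto simp: lookup_part2[OF _ _ \<phi>] index2_def weights2_in_def)
qed

text \<open>The weight spaces are defined as spans of typed cochains, so comparing them reduces to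
  elementary cochains. The finiteness of the generating set later provides the finite set needed for
  the orthogonal projection.\<close>

lemma weights1_in_eq_span: "weights1_in W = span ((\<lambda>(a, k). elem1 a k) ` index1 W)"
proof
  show "weights1_in W \<subseteq> span ((\<lambda>(a, k). elem1 a k) ` index1 W)"
  proof
    fix \<phi> assume "\<phi> \<in> weights1_in W"
    then have "\<phi> = part1 W \<phi>" by (simp add: part1_eq)
    also have "\<dots> \<in> span ((\<lambda>(a, k). elem1 a k) ` index1 W)"
      unfolding part1_def
      by (rule span_sum, clarify, intro span_scale span_base rev_image_eqI) auto
    finally show "\<phi> \<in> span ((\<lambda>(a, k). elem1 a k) ` index1 W)" .
  qed
  show "span ((\<lambda>(a, k). elem1 a k) ` index1 W) \<subseteq> weights1_in W"
    by (rule span_minimal[OF _ subspace_weights1_in]) (auto intro: elem1_in_weights)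
qed

lemma weights2_in_eq_span: "weights2_in W = span ((\<lambda>(a, b, k). elem2 a b k) ` index2 W)"
proof
  show "weights2_in W \<subseteq> span ((\<lambda>(a, b, k). elem2 a b k) ` index2 W)"
  proof
    fix \<phi> assume "\<phi> \<in> weights2_in W"
    then have "\<phi> = part2 W \<phi>" by (simp add: part2_eq)
    also have "\<dots> \<in> span ((\<lambda>(a, b, k). elem2 a b k) ` index2 W)"
      unfolding part2_def
      by (rule span_sum, clarify, intro span_scale span_base rev_image_eqI) auto
    finally show "\<phi> \<in> span ((\<lambda>(a, b, k). elem2 a b k) ` index2 W)" .
  qed
  show "span ((\<lambda>(a, b, k). elem2 a b k) ` index2 W) \<subseteq> weights2_in W"
    by (rule span_minimal[OF _ subspace_weights2_in]) (auto intro: elem2_in_weights)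
qed

section \<open>Weight spaces and positive cochains described by coordinates\<close>

lemma cochains1_weight_eq: "cochains1_weight G w = weights1_in {w}"
proof
  show "cochains1_weight G w \<subseteq> weights1_in {w}"
    unfolding cochains1_weight_def
    by (rule span_minimal[OF _ subspace_weights1_in]) (use cochains1_type_subset in blast)
  show "weights1_in {w} \<subseteq> cochains1_weight G w"
    unfolding weights1_in_eq_span cochains1_weight_def
  proof (rule span_mono, safe)
    fix a k assume "(a, k) \<in> index1 {w}"
    then show "elem1 a k \<in> \<Union> {cochains1_type G i j |i j. i < 0 \<and> j - i = w}"
      by (intro UnionI[of "cochains1_type G (wght G a) (wght G k)"])
         (auto simp: index1_def neg_basis_def intro: elem1_in_type)
  qed
qed

lemma cochains2_weight_eq: "cochains2_weight G w = weights2_in {w}"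
proof
  show "cochains2_weight G w \<subseteq> weights2_in {w}"
    unfolding cochains2_weight_def
    by (rule span_minimal[OF _ subspace_weights2_in]) (use cochains2_type_subset in blast)
  show "weights2_in {w} \<subseteq> cochains2_weight G w"
    unfolding weights2_in_eq_span cochains2_weight_def
  proof (rule span_mono, safe)
    fix a b k assume "(a, b, k) \<in> index2 {w}"
    then show "elem2 a b k \<in> \<Union> {cochains2_type G i1 i2 j |i1 i2 j.
      i1 < 0 \<and> i2 < 0 \<and> j - (i1 + i2) = w}"
      by (intro UnionI[of "cochains2_type G (wght G a) (wght G b) (wght G k)"])
         (auto simp: index2_def neg_basis_def intro: elem2_in_type)
  qed
qed

lemma pos_cochains1_eq: "pos_cochains1 G = weights1_in {0<..}"
proof
  show "pos_cochains1 G \<subseteq> weights1_in {0<..}"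
    unfolding pos_cochains1_def cochains1_weight_eq
    by (rule span_minimal[OF UN_least subspace_weights1_in], rule weights1_in_mono) simp
  show "weights1_in {0<..} \<subseteq> pos_cochains1 G"
    unfolding weights1_in_eq_span[of "{0<..}"] pos_cochains1_def cochains1_weight_eq
    by (rule span_mono) (fastforce simp: index1_def intro: elem1_in_weights)
qed

text \<open>The coordinate terms of a cochain form a finite sum; grouping them by weight gives its
  components. Only finitely many weights occur, even when \<open>W\<close> is infinite.\<close>

lemma weights2_in_subset_span:
  assumes "\<phi> \<in> weights2_in W"
  shows "\<phi> \<in> span ((\<lambda>w. part2 {w} \<phi>) ` W)"
proof -
  define wt where "wt = (\<lambda>(a, b, k). wght G k - (wght G a + wght G b))"
  let ?h = "\<lambda>(a, b, k). (Poly_Mapping.lookup (\<phi> (basis_vec a) (basis_vec b)) k / 2) *\<^sub>R elem2 a b k"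
  have "\<phi> = sum ?h (index2 W)"
    using part2_eq[OF assms] by (simp add: part2_def)
  also have "\<dots> = (\<Sum>w\<in>wt ` index2 W. sum ?h {p \<in> index2 W. wt p = w})"
    by (rule sum.group[symmetric]) auto
  also have "\<dots> = (\<Sum>w\<in>wt ` index2 W. part2 {w} \<phi>)"
    unfolding part2_def by (intro sum.cong refl) (auto simp: index2_def wt_def)
  also have "\<dots> \<in> span ((\<lambda>w. part2 {w} \<phi>) ` W)"
    by (intro span_sum span_base) (auto simp: index2_def wt_def)
  finally show ?thesis .
qed

lemma pos_cochains2_eq: "pos_cochains2 G = weights2_in {0<..}"
proof
  show "pos_cochains2 G \<subseteq> weights2_in {0<..}"
    unfolding pos_cochains2_def cochains2_weight_eq
    by (rule span_minimal[OF UN_least subspace_weights2_in], rule weights2_in_mono) simp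
  show "weights2_in {0<..} \<subseteq> pos_cochains2 G"
    unfolding weights2_in_eq_span[of "{0<..}"] pos_cochains2_def cochains2_weight_eq
    by (rule span_mono) (fastforce simp: index2_def intro: elem2_in_weights)
qed

subsection \<open>The inner product\<close>

definition ip :: "('b \<Rightarrow>\<^sub>0 real) \<Rightarrow> ('b \<Rightarrow>\<^sub>0 real) \<Rightarrow> real"
  where "ip u v = (\<Sum>k\<in>basis G. q k * Poly_Mapping.lookup u k * Poly_Mapping.lookup v k)"

text \<open>The denominators are there because the dual vector of \<open>a\<close> has squared norm
  \<open>1 / q a\<close>. Summing over ordered pairs counts every wedge of two basis elements twice,
  which only rescales the inner product on cochains.\<close>

definition ip2 :: "'b cochain2 \<Rightarrow> 'b cochain2 \<Rightarrow> real"
  where "ip2 \<phi> \<theta> = (\<Sum>a\<in>neg_basis. \<Sum>b\<in>neg_basis.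
    ip (\<phi> (basis_vec a) (basis_vec b)) (\<theta> (basis_vec a) (basis_vec b)) / (q a * q b))"

lemma bilinear_ip: "bilinear ip"
  unfolding bilinear_def
  by (intro conjI allI linearI)
     (simp_all add: ip_def lookup_linear sum.distrib sum_distrib_left algebra_simps)

lemma ip_commute: "ip u v = ip v u"
  by (simp add: ip_def mult.commute mult.left_commute)

lemmas ip_simps = bilinear_ladd[OF bilinear_ip] bilinear_radd[OF bilinear_ip]
  bilinear_lsub[OF bilinear_ip] bilinear_rsub[OF bilinear_ip]
  bilinear_lmul[OF bilinear_ip] bilinear_rmul[OF bilinear_ip]

lemma bilinear_ip2: "bilinear ip2"
  unfolding bilinear_def
  by (intro conjI allI linearI)
     (simp_all add: ip2_def ip_simps sum.distrib sum_distrib_left add_divide_distrib)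

lemma ip2_commute: "ip2 \<phi> \<theta> = ip2 \<theta> \<phi>"
  unfolding ip2_def by (intro sum.cong refl arg_cong2[where f = "(/)"] ip_commute)

lemma ip_nonneg: "0 \<le> ip u u"
  unfolding ip_def using q_pos by (intro sum_nonneg) (auto simp: mult.assoc less_imp_le)

lemma ip_self_eq_0:
  assumes "u \<in> lie_space G" "ip u u = 0"
  shows "u = 0"
proof (rule poly_mapping_eqI)
  fix k
  have "q k * Poly_Mapping.lookup u k * Poly_Mapping.lookup u k = 0" if "k \<in> basis G"
    using assms(2) that finite_basis q_pos unfolding ip_def
    by (subst (asm) sum_nonneg_eq_0_iff) (auto simp: mult.assoc less_imp_le)
  then show "Poly_Mapping.lookup u k = Poly_Mapping.lookup 0 k"
    using assms(1) q_pos[of k] by (cases "k \<in> basis G") (auto simp: lie_space_iff in_keys_iff)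
qed

lemma cochains2_in_lie_space: "\<phi> \<in> cochains2 G \<Longrightarrow> \<phi> x y \<in> lie_space G"
  by (simp add: cochains2_def)

lemma cochains1_in_lie_space: "\<phi> \<in> cochains1 G \<Longrightarrow> \<phi> x \<in> lie_space G"
  by (simp add: cochains1_def)

text \<open>\<open>ip2\<close> sees a function only on basis vectors of \<mm>, and only the
  coordinates in \<open>basis G\<close>. Definiteness therefore rests on cochains being determined
  by these values and taking values in \<open>lie_space G\<close>.\<close>

lemma ip2_self_eq_0:
  assumes "\<phi> \<in> cochains2 G" "ip2 \<phi> \<phi> = 0"
  shows "\<phi> = 0"
proof (rule cochains2_eqI[OF assms(1) subspace_0[OF subspace_cochains2]])
  fix a b assume ab: "a \<in> neg_basis" "b \<in> neg_basis"
  let ?f = "\<lambda>a b. ip (\<phi> (basis_vec a) (basis_vec b)) (\<phi> (basis_vec a) (basis_vec b)) / (q a * q b)"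
  have q: "q c > 0" if "c \<in> neg_basis" for c
    using that by (simp add: q_pos neg_basis_in_basis)
  have nonneg: "0 \<le> ?f c d" if "c \<in> neg_basis" "d \<in> neg_basis" for c d
    using q[OF that(1)] q[OF that(2)] ip_nonneg by simp
  have "(\<Sum>d\<in>neg_basis. ?f a d) = 0"
    using assms(2) ab(1) nonneg unfolding ip2_def
    by (subst (asm) sum_nonneg_eq_0_iff) (auto intro!: sum_nonneg)
  then have "?f a b = 0"
    using ab nonneg by (subst (asm) sum_nonneg_eq_0_iff) auto
  then have "ip (\<phi> (basis_vec a) (basis_vec b)) (\<phi> (basis_vec a) (basis_vec b)) = 0"
    using q[OF ab(1)] q[OF ab(2)] by simp
  then show "\<phi> (basis_vec a) (basis_vec b) = 0 (basis_vec a) (basis_vec b)"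
    using ip_self_eq_0[OF cochains2_in_lie_space[OF assms(1)]] by simp
qed

text \<open>The orthogonal basis is homogeneous, so cochains with disjoint sets of weights have no
  nonzero coordinate in common.\<close>

lemma ip2_weights_orthogonal:
  assumes "\<phi> \<in> weights2_in W" "\<theta> \<in> weights2_in (- W)"
  shows "ip2 \<phi> \<theta> = 0"
proof -
  have "Poly_Mapping.lookup (\<phi> (basis_vec a) (basis_vec b)) k = 0
      \<or> Poly_Mapping.lookup (\<theta> (basis_vec a) (basis_vec b)) k = 0"
    if "a \<in> neg_basis" "b \<in> neg_basis" for a b k
    using assms that unfolding weights2_in_def by blast
  then have "ip (\<phi> (basis_vec a) (basis_vec b)) (\<theta> (basis_vec a) (basis_vec b)) = 0"
    if "a \<in> neg_basis" "b \<in> neg_basis" for a b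
    unfolding ip_def using that by (intro sum.neutral ballI) simp
  then show ?thesis
    by (simp add: ip2_def)
qed

section \<open>Adjoints of the actions on the algebra and on 2-cochains\<close>

lemma adjointD:
  assumes "ad_adjoint G q z z'" "a \<in> basis G" "b \<in> basis G"
  shows "q b * Poly_Mapping.lookup (basis_bracket G z a) b
    = q a * Poly_Mapping.lookup (basis_bracket G z' b) a"
  using assms by (auto simp: ad_adjoint_def)

lemma lookup_bracket_basis_vec:
  assumes "u \<in> lie_space G"
  shows "Poly_Mapping.lookup (lie_bracket G (basis_vec z) u) k
    = (\<Sum>c\<in>basis G. Poly_Mapping.lookup u c * Poly_Mapping.lookup (basis_bracket G z c) k)"
  using assms finite_basis
  by (simp add: lie_bracket_superset[of "{z}" "basis G"] lie_space_iff lookup_linear lookup_basis_vec)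

lemma ip_bracket_adjoint:
  assumes z: "ad_adjoint G q z z'" and u: "u \<in> lie_space G" and v: "v \<in> lie_space G"
  shows "ip (lie_bracket G (basis_vec z) u) v = ip u (lie_bracket G (basis_vec z') v)"
proof -
  let ?l = "Poly_Mapping.lookup"
  have "ip (lie_bracket G (basis_vec z) u) v
    = (\<Sum>k\<in>basis G. \<Sum>c\<in>basis G. ?l u c * ?l v k * (q k * ?l (basis_bracket G z c) k))"
    by (simp add: ip_def lookup_bracket_basis_vec[OF u] sum_distrib_left sum_distrib_right mult_ac)
  also have "\<dots> = (\<Sum>k\<in>basis G. \<Sum>c\<in>basis G. ?l u c * ?l v k * (q c * ?l (basis_bracket G z' k) c))"
    by (intro sum.cong refl) (simp only: adjointD[OF z])
  also have "\<dots> = (\<Sum>c\<in>basis G. \<Sum>k\<in>basis G. ?l u c * ?l v k * (q c * ?l (basis_bracket G z' k) c))"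
    by (rule sum.swap)
  also have "\<dots> = ip u (lie_bracket G (basis_vec z') v)"
    by (simp add: ip_def lookup_bracket_basis_vec[OF v] sum_distrib_left sum_distrib_right mult_ac)
  finally show ?thesis .
qed

text \<open>This is adjointness on the dual of \<mm>: dividing the relation of
  \<open>ad_adjoint\<close> by \<open>q a * q c\<close> gives the transposed relation for the
  squared norms \<open>1 / q\<close>. Restricting the sums to \<open>neg_basis\<close> drops the
  components of [z, a] in \<open>\<gg>\<^sup>0\<close>, that is, uses the matrix of \<open>z\<close>
  on the quotient. The kernel \<open>f\<close> carries the remaining factors of the inner
  product.\<close>

lemma sum_adjoint_transpose:
  assumes "ad_adjoint G q z z'"
  shows "(\<Sum>a\<in>neg_basis. \<Sum>c\<in>neg_basis.
      Poly_Mapping.lookup (basis_bracket G z a) c * f c a / q a)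
    = (\<Sum>a\<in>neg_basis. \<Sum>c\<in>neg_basis.
      Poly_Mapping.lookup (basis_bracket G z' a) c * f a c / q a)"
proof -
  have "Poly_Mapping.lookup (basis_bracket G z a) c * f c a / q a
    = Poly_Mapping.lookup (basis_bracket G z' c) a * f c a / q c"
    if "a \<in> neg_basis" "c \<in> neg_basis" for a c
    using adjointD[OF assms, of a c] q_pos[of a] q_pos[of c] that
    by (simp add: neg_basis_in_basis field_simps)
  then have "(\<Sum>a\<in>neg_basis. \<Sum>c\<in>neg_basis.
      Poly_Mapping.lookup (basis_bracket G z a) c * f c a / q a)
    = (\<Sum>a\<in>neg_basis. \<Sum>c\<in>neg_basis.
      Poly_Mapping.lookup (basis_bracket G z' c) a * f c a / q c)"
    by (intro sum.cong refl) auto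
  also have "\<dots> = (\<Sum>a\<in>neg_basis. \<Sum>c\<in>neg_basis.
      Poly_Mapping.lookup (basis_bracket G z' a) c * f a c / q a)"
    by (rule sum.swap)
  finally show ?thesis .
qed

lemma cochains2_expand_left:
  assumes "\<phi> \<in> cochains2 G" "b \<in> neg_basis"
  shows "\<phi> x (basis_vec b) = (\<Sum>c\<in>neg_basis. Poly_Mapping.lookup x c *\<^sub>R \<phi> (basis_vec c) (basis_vec b))"
proof -
  have "\<phi> x (basis_vec b) = (\<Sum>c\<in>neg_basis. \<Sum>d\<in>neg_basis.
    if d = b then Poly_Mapping.lookup x c *\<^sub>R \<phi> (basis_vec c) (basis_vec b) else 0)"
    unfolding cochains2_expand[OF assms(1), of x "basis_vec b"]
    by (intro sum.cong refl) (simp add: lookup_basis_vec)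
  then show ?thesis
    using assms(2) by simp
qed

lemma cochains2_expand_right:
  assumes "\<phi> \<in> cochains2 G" "a \<in> neg_basis"
  shows "\<phi> (basis_vec a) x = (\<Sum>c\<in>neg_basis. Poly_Mapping.lookup x c *\<^sub>R \<phi> (basis_vec a) (basis_vec c))"
proof -
  have "- (c *\<^sub>R \<phi> (basis_vec d) (basis_vec a)) = c *\<^sub>R \<phi> (basis_vec a) (basis_vec d)" for c d
    using cochains2_antisym[OF assms(1), of "basis_vec d" "basis_vec a"] by simp
  then show ?thesis
    by (simp only: cochains2_antisym[OF assms(1), of "basis_vec a" x] cochains2_expand_left[OF assms, of x]
        sum_negf[symmetric])
qed

lemma action_basis_vec:
  assumes "\<phi> \<in> cochains2 G" "a \<in> neg_basis" "b \<in> neg_basis"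
  shows "cochain2_action G (basis_vec z) \<phi> (basis_vec a) (basis_vec b)
    = lie_bracket G (basis_vec z) (\<phi> (basis_vec a) (basis_vec b))
      - (\<Sum>c\<in>neg_basis. Poly_Mapping.lookup (basis_bracket G z a) c *\<^sub>R \<phi> (basis_vec c) (basis_vec b))
      - (\<Sum>c\<in>neg_basis. Poly_Mapping.lookup (basis_bracket G z b) c *\<^sub>R \<phi> (basis_vec a) (basis_vec c))"
  using assms by (simp add: cochain2_action_def Let_def cochains2_expand_left[OF assms(1,3), of "basis_bracket G z a"]
      cochains2_expand_right[OF assms(1,2), of "basis_bracket G z b"])

lemma ip_sum_left: "ip (\<Sum>c\<in>A. f c *\<^sub>R u c) v = (\<Sum>c\<in>A. f c * ip (u c) v)"
  using bilinear_ip linear_apply_sum[of "\<lambda>u. ip u v" f u A] by (simp add: bilinear_def)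

lemma ip_sum_right: "ip u (\<Sum>c\<in>A. f c *\<^sub>R v c) = (\<Sum>c\<in>A. f c * ip u (v c))"
  using ip_sum_left[of f v A u] by (simp add: ip_commute)

lemma ip2_action_adjoint:
  assumes z: "ad_adjoint G q z z'" and \<phi>: "\<phi> \<in> cochains2 G" and \<theta>: "\<theta> \<in> cochains2 G"
  shows "ip2 (cochain2_action G (basis_vec z) \<phi>) \<theta> = ip2 \<phi> (cochain2_action G (basis_vec z') \<theta>)"
proof -
  let ?l = "\<lambda>z a. Poly_Mapping.lookup (basis_bracket G z a)" and ?M = neg_basis
  let ?p = "\<lambda>a b. \<phi> (basis_vec a) (basis_vec b)" and ?c = "\<lambda>a b. \<theta> (basis_vec a) (basis_vec b)"
  let ?I = "\<lambda>a b c d. ip (?p a b) (?c c d)"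
  have "ip2 (cochain2_action G (basis_vec z) \<phi>) \<theta>
    = (\<Sum>a\<in>?M. \<Sum>b\<in>?M. ip (lie_bracket G (basis_vec z) (?p a b)) (?c a b) / (q a * q b)
        - (\<Sum>c\<in>?M. ?l z a c * ?I c b a b) / (q a * q b)
        - (\<Sum>c\<in>?M. ?l z b c * ?I a c a b) / (q a * q b))"
    unfolding ip2_def
    by (intro sum.cong refl)
       (simp add: action_basis_vec[OF \<phi>] ip_simps ip_sum_left diff_divide_distrib)
  \<comment> \<open>In the term for the first argument \<open>b\<close> is moved outermost, and in
    both argument terms the norm of the untouched argument is absorbed into the kernel. The inner
    double sums then have the shape of \<open>sum_adjoint_transpose\<close>.\<close>
  also have "\<dots> = (\<Sum>a\<in>?M. \<Sum>b\<in>?M. ip (lie_bracket G (basis_vec z) (?p a b)) (?c a b) / (q a * q b))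
      - (\<Sum>b\<in>?M. \<Sum>a\<in>?M. \<Sum>c\<in>?M. ?l z a c * (?I c b a b / q b) / q a)
      - (\<Sum>a\<in>?M. \<Sum>b\<in>?M. \<Sum>c\<in>?M. ?l z b c * (?I a c a b / q a) / q b)"
    unfolding sum.swap[of _ ?M ?M, where g = "\<lambda>b a. \<Sum>c\<in>?M. ?l z a c * (?I c b a b / q b) / q a"]
    by (simp add: sum_subtractf sum_divide_distrib mult_ac)
  also have "(\<Sum>b\<in>?M. \<Sum>a\<in>?M. \<Sum>c\<in>?M. ?l z a c * (?I c b a b / q b) / q a)
    = (\<Sum>b\<in>?M. \<Sum>a\<in>?M. \<Sum>c\<in>?M. ?l z' a c * (?I a b c b / q b) / q a)"
    by (intro sum.cong refl sum_adjoint_transpose[OF z])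
  also have "(\<Sum>a\<in>?M. \<Sum>b\<in>?M. \<Sum>c\<in>?M. ?l z b c * (?I a c a b / q a) / q b)
    = (\<Sum>a\<in>?M. \<Sum>b\<in>?M. \<Sum>c\<in>?M. ?l z' b c * (?I a b a c / q a) / q b)"
    by (intro sum.cong refl sum_adjoint_transpose[OF z])
  also have "(\<Sum>a\<in>?M. \<Sum>b\<in>?M. ip (lie_bracket G (basis_vec z) (?p a b)) (?c a b) / (q a * q b))
    = (\<Sum>a\<in>?M. \<Sum>b\<in>?M. ip (?p a b) (lie_bracket G (basis_vec z') (?c a b)) / (q a * q b))"
    by (simp add: ip_bracket_adjoint[OF z] cochains2_in_lie_space \<phi> \<theta>)
  also have "(\<Sum>a\<in>?M. \<Sum>b\<in>?M. ip (?p a b) (lie_bracket G (basis_vec z') (?c a b)) / (q a * q b))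
      - (\<Sum>b\<in>?M. \<Sum>a\<in>?M. \<Sum>c\<in>?M. ?l z' a c * (?I a b c b / q b) / q a)
      - (\<Sum>a\<in>?M. \<Sum>b\<in>?M. \<Sum>c\<in>?M. ?l z' b c * (?I a b a c / q a) / q b)
    = (\<Sum>a\<in>?M. \<Sum>b\<in>?M. ip (?p a b) (lie_bracket G (basis_vec z') (?c a b)) / (q a * q b)
        - (\<Sum>c\<in>?M. ?l z' a c * ?I a b c b) / (q a * q b)
        - (\<Sum>c\<in>?M. ?l z' b c * ?I a b a c) / (q a * q b))"
    unfolding sum.swap[of _ ?M ?M, where g = "\<lambda>b a. \<Sum>c\<in>?M. ?l z' a c * (?I a b c b / q b) / q a"]
    by (simp add: sum_subtractf sum_divide_distrib mult_ac)
  also have "\<dots> = ip2 \<phi> (cochain2_action G (basis_vec z') \<theta>)"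
    unfolding ip2_def
    by (intro sum.cong refl)
       (simp add: action_basis_vec[OF \<theta>] ip_simps ip_sum_right diff_divide_distrib)
  finally show ?thesis .
qed

subsection \<open>The coboundary\<close>

lemma cochains1_linear: "\<psi> \<in> cochains1 G \<Longrightarrow> linear \<psi>"
  by (simp add: cochains1_def)

lemma cochains2_bilinear: "\<phi> \<in> cochains2 G \<Longrightarrow> bilinear \<phi>"
  by (simp add: cochains2_def)

lemma linear_coboundary1: "linear (coboundary1 G)"
  by (rule linearI)
     (simp_all add: coboundary1_def Let_def fun_eq_iff lie_bracket_simps algebra_simps)

lemma coboundary1_neg:
  assumes "Poly_Mapping.keys x \<subseteq> neg_basis" "Poly_Mapping.keys y \<subseteq> neg_basis"
  shows "coboundary1 G \<psi> x y = lie_bracket G x (\<psi> y) - lie_bracket G y (\<psi> x) - \<psi> (lie_bracket G x y)"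
  using assms by (simp add: coboundary1_def Let_def neg_proj_id)

lemma coboundary1_in_cochains2:
  assumes \<psi>: "\<psi> \<in> cochains1 G"
  shows "coboundary1 G \<psi> \<in> cochains2 G"
proof -
  note lin = linear_add[OF cochains1_linear[OF \<psi>]] linear_scale[OF cochains1_linear[OF \<psi>]]
    linear_0[OF cochains1_linear[OF \<psi>]]
    linear_add[OF linear_neg_proj] linear_scale[OF linear_neg_proj]
  have "bilinear (coboundary1 G \<psi>)"
    unfolding bilinear_def
    by (intro conjI allI linearI)
       (simp_all add: coboundary1_def Let_def lin lie_bracket_simps algebra_simps)
  moreover have "coboundary1 G \<psi> x x = 0" for x
    by (simp add: coboundary1_def Let_def lie_bracket_self lin)
  moreover have "coboundary1 G \<psi> x y \<in> lie_space G" for x y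
    unfolding coboundary1_def Let_def
    by (intro subspace_diff[OF subspace_lie_space] lie_bracket_in_lie_space
        cochains1_in_lie_space[OF \<psi>] neg_proj_in_lie_space)
  moreover have "coboundary1 G \<psi> x y = coboundary1 G \<psi> (neg_proj G x) (neg_proj G y)" for x y
    by (simp add: coboundary1_def)
  ultimately show ?thesis
    unfolding cochains2_def by blast
qed

lemma lookup_bracket_nonzeroD:
  assumes "a \<in> basis G" "u \<in> lie_space G" "Poly_Mapping.lookup (lie_bracket G (basis_vec a) u) k \<noteq> 0"
  obtains c where "c \<in> basis G" "Poly_Mapping.lookup u c \<noteq> 0" "wght G k = wght G a + wght G c"
proof -
  from assms(3) obtain c where "Poly_Mapping.lookup u c * Poly_Mapping.lookup (basis_bracket G a c) k \<noteq> 0"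
    and c: "c \<in> basis G"
    unfolding lookup_bracket_basis_vec[OF assms(2)] by (meson sum.neutral)
  then have "Poly_Mapping.lookup u c \<noteq> 0" "k \<in> Poly_Mapping.keys (basis_bracket G a c)"
    by (auto simp: in_keys_iff)
  with bracket_graded[OF assms(1) c] c that show ?thesis by blast
qed

text \<open>Since the bracket is graded, every term of the coboundary formula preserves weight:
  \<open>*\<close> treats the two brackets with values of \<psi>, \<open>**\<close> the value of
  \<psi> on a bracket.\<close>

lemma coboundary1_in_weights2:
  assumes "\<psi> \<in> weights1_in W"
  shows "coboundary1 G \<psi> \<in> weights2_in W"
proof -
  have \<psi>: "\<psi> \<in> cochains1 G"
    and W: "\<And>a k. a \<in> neg_basis \<Longrightarrow> Poly_Mapping.lookup (\<psi> (basis_vec a)) k \<noteq> 0 \<Longrightarrow>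
      wght G k - wght G a \<in> W"
    using assms by (auto simp: weights1_in_def)
  have *: "wght G k - (wght G a + wght G b) \<in> W"
    if a: "a \<in> neg_basis" and b: "b \<in> neg_basis"
      and k: "Poly_Mapping.lookup (lie_bracket G (basis_vec a) (\<psi> (basis_vec b))) k \<noteq> 0" for a b k
  proof -
    obtain c where "Poly_Mapping.lookup (\<psi> (basis_vec b)) c \<noteq> 0" "wght G k = wght G a + wght G c"
      using lookup_bracket_nonzeroD[OF neg_basis_in_basis[OF a] cochains1_in_lie_space[OF \<psi>] k] .
    with W[OF b] show ?thesis by fastforce
  qed
  have **: "wght G k - (wght G a + wght G b) \<in> W"
    if ab: "a \<in> neg_basis" "b \<in> neg_basis"
      and k: "Poly_Mapping.lookup (\<psi> (basis_bracket G a b)) k \<noteq> 0" for a b k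
  proof -
    from k obtain c where "Poly_Mapping.lookup (basis_bracket G a b) c *
        Poly_Mapping.lookup (\<psi> (basis_vec c)) k \<noteq> 0"
      and c: "c \<in> neg_basis"
      unfolding cochains1_expand[OF \<psi>, of "basis_bracket G a b"] lookup_sum lookup_scaleR
      by (meson sum.neutral)
    then have "c \<in> Poly_Mapping.keys (basis_bracket G a b)"
      and "Poly_Mapping.lookup (\<psi> (basis_vec c)) k \<noteq> 0" by (auto simp: in_keys_iff)
    moreover from this(1) have "wght G c = wght G a + wght G b"
      using bracket_graded[of a b] ab by (auto dest!: neg_basis_in_basis)
    ultimately show ?thesis using W[OF c] by simp
  qed
  have "wght G k - (wght G a + wght G b) \<in> W"
    if ab: "a \<in> neg_basis" "b \<in> neg_basis"
      and k: "Poly_Mapping.lookup (coboundary1 G \<psi> (basis_vec a) (basis_vec b)) k \<noteq> 0" for a b k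
  proof -
    have "Poly_Mapping.lookup (lie_bracket G (basis_vec a) (\<psi> (basis_vec b))) k \<noteq> 0
      \<or> Poly_Mapping.lookup (lie_bracket G (basis_vec b) (\<psi> (basis_vec a))) k \<noteq> 0
      \<or> Poly_Mapping.lookup (\<psi> (basis_bracket G a b)) k \<noteq> 0"
      using k ab by (auto simp: coboundary1_neg lookup_minus)
    with *[OF ab] *[OF ab(2,1)] **[OF ab] show ?thesis
      by (auto simp: add.commute)
  qed
  with coboundary1_in_cochains2[OF \<psi>] show ?thesis
    by (simp add: weights2_in_def)
qed

subsection \<open>The actions on cochains\<close>

text \<open>The counterpart of \<open>cochain2_action\<close> in degree one. It supplies the
  1-cochain that exhibits the image of a coboundary under the action as a coboundary again.\<close>

definition cochain1_action :: "('b \<Rightarrow>\<^sub>0 real) \<Rightarrow> 'b cochain1 \<Rightarrow> 'b cochain1"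
  where "cochain1_action z \<psi> = (\<lambda>x. lie_bracket G z (\<psi> (neg_proj G x)) - \<psi> (lie_bracket G z (neg_proj G x)))"

lemma cochain1_action_in_cochains1:
  assumes \<psi>: "\<psi> \<in> cochains1 G" and z: "z \<in> lie_space G"
  shows "cochain1_action z \<psi> \<in> cochains1 G"
proof -
  note lin = linear_add[OF cochains1_linear[OF \<psi>]] linear_scale[OF cochains1_linear[OF \<psi>]]
    linear_add[OF linear_neg_proj] linear_scale[OF linear_neg_proj]
  have "linear (cochain1_action z \<psi>)"
    by (rule linearI) (simp_all add: cochain1_action_def lin lie_bracket_simps algebra_simps)
  moreover have "cochain1_action z \<psi> x \<in> lie_space G" for x
    unfolding cochain1_action_def
    by (intro subspace_diff[OF subspace_lie_space] lie_bracket_in_lie_space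
        cochains1_in_lie_space[OF \<psi>] z)
  moreover have "cochain1_action z \<psi> x = cochain1_action z \<psi> (neg_proj G x)" for x
    by (simp add: cochain1_action_def)
  ultimately show ?thesis
    unfolding cochains1_def by blast
qed

lemma cochain2_action_in_cochains2:
  assumes \<phi>: "\<phi> \<in> cochains2 G" and z: "z \<in> lie_space G"
  shows "cochain2_action G z \<phi> \<in> cochains2 G"
proof -
  note bil = bilinear_ladd[OF cochains2_bilinear[OF \<phi>]] bilinear_lmul[OF cochains2_bilinear[OF \<phi>]]
    bilinear_radd[OF cochains2_bilinear[OF \<phi>]] bilinear_rmul[OF cochains2_bilinear[OF \<phi>]]
    linear_add[OF linear_neg_proj] linear_scale[OF linear_neg_proj]
  have "bilinear (cochain2_action G z \<phi>)"
    unfolding bilinear_def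
    by (intro conjI allI linearI)
       (simp_all add: cochain2_action_def Let_def bil lie_bracket_simps algebra_simps)
  moreover have "cochain2_action G z \<phi> x x = 0" for x
    using cochains2_antisym[OF \<phi>, of "lie_bracket G z (neg_proj G x)" "neg_proj G x"] \<phi>
    by (simp add: cochain2_action_def Let_def cochains2_def lie_bracket_simps)
  moreover have "cochain2_action G z \<phi> x y \<in> lie_space G" for x y
    unfolding cochain2_action_def Let_def
    by (intro subspace_diff[OF subspace_lie_space] lie_bracket_in_lie_space
        cochains2_in_lie_space[OF \<phi>] z)
  moreover have "cochain2_action G z \<phi> x y = cochain2_action G z \<phi> (neg_proj G x) (neg_proj G y)" for x y
    by (simp add: cochain2_action_def)
  ultimately show ?thesis
    unfolding cochains2_def by blast
qed

text \<open>Each term raises the weight by \<open>wght G z\<close>: bracketing the value raises its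
  degree by this amount, and an argument \<open>a\<close> is replaced by elements \<open>c\<close>
  whose degree exceeds that of \<open>a\<close> by the same amount.\<close>

lemma cochain2_action_in_weights2:
  assumes "\<phi> \<in> weights2_in {0<..}" "z \<in> basis G" "0 \<le> wght G z"
  shows "cochain2_action G (basis_vec z) \<phi> \<in> weights2_in {0<..}"
proof -
  have \<phi>: "\<phi> \<in> cochains2 G"
    and W: "\<And>a b k. a \<in> neg_basis \<Longrightarrow> b \<in> neg_basis \<Longrightarrow>
      Poly_Mapping.lookup (\<phi> (basis_vec a) (basis_vec b)) k \<noteq> 0 \<Longrightarrow>
      wght G a + wght G b < wght G k"
    using assms(1) by (auto simp: weights2_in_def)
  have *: "wght G c = wght G z + wght G a"
    if "a \<in> neg_basis" "Poly_Mapping.lookup (basis_bracket G z a) c \<noteq> 0" for a c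
    using bracket_graded[OF assms(2) neg_basis_in_basis[OF that(1)]] that(2) by (auto simp: in_keys_iff)
  have "wght G a + wght G b < wght G k"
    if ab: "a \<in> neg_basis" "b \<in> neg_basis"
      and k: "Poly_Mapping.lookup (cochain2_action G (basis_vec z) \<phi> (basis_vec a) (basis_vec b)) k \<noteq> 0"
    for a b k
  proof -
    consider "Poly_Mapping.lookup (lie_bracket G (basis_vec z) (\<phi> (basis_vec a) (basis_vec b))) k \<noteq> 0"
      | "(\<Sum>c\<in>neg_basis. Poly_Mapping.lookup (basis_bracket G z a) c *
          Poly_Mapping.lookup (\<phi> (basis_vec c) (basis_vec b)) k) \<noteq> 0"
      | "(\<Sum>c\<in>neg_basis. Poly_Mapping.lookup (basis_bracket G z b) c *
          Poly_Mapping.lookup (\<phi> (basis_vec a) (basis_vec c)) k) \<noteq> 0"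
      using k unfolding action_basis_vec[OF \<phi> ab] lookup_minus lookup_sum lookup_scaleR by linarith
    then show ?thesis
    proof cases
      case 1
      then obtain c where "Poly_Mapping.lookup (\<phi> (basis_vec a) (basis_vec b)) c \<noteq> 0"
        "wght G k = wght G z + wght G c"
        using lookup_bracket_nonzeroD[OF assms(2) cochains2_in_lie_space[OF \<phi>]] by metis
      with W[OF ab] assms(3) show ?thesis by fastforce
    next
      case 2
      then obtain c where "c \<in> neg_basis" "Poly_Mapping.lookup (basis_bracket G z a) c *
          Poly_Mapping.lookup (\<phi> (basis_vec c) (basis_vec b)) k \<noteq> 0"
        by (meson sum.neutral)
      with W[of c b k] *[of a c] ab assms(3) show ?thesis by fastforce
    next
      case 3
      then obtain c where "c \<in> neg_basis" "Poly_Mapping.lookup (basis_bracket G z b) c *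
          Poly_Mapping.lookup (\<phi> (basis_vec a) (basis_vec c)) k \<noteq> 0"
        by (meson sum.neutral)
      with W[of a c k] *[of b c] ab assms(3) show ?thesis by fastforce
    qed
  qed
  with cochain2_action_in_cochains2[OF \<phi>] assms(2) show ?thesis
    by (simp add: weights2_in_def)
qed

lemma derivation_lie_bracket:
  assumes "ad_derivation G z" and u: "u \<in> lie_space G" and v: "v \<in> lie_space G"
  shows "lie_bracket G (basis_vec z) (lie_bracket G u v)
    = lie_bracket G (lie_bracket G (basis_vec z) u) v + lie_bracket G u (lie_bracket G (basis_vec z) v)"
  using u unfolding lie_space_def
proof (induction rule: span_induct_alt)
  case base
  then show ?case by (simp add: lie_bracket_simps)
next
  case (step c x y)
  have "lie_bracket G (basis_vec z) (lie_bracket G x v)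
    = lie_bracket G (lie_bracket G (basis_vec z) x) v + lie_bracket G x (lie_bracket G (basis_vec z) v)"
    using v unfolding lie_space_def
  proof (induction rule: span_induct_alt)
    case base
    then show ?case by (simp add: lie_bracket_simps)
  next
    case (step c' x' y')
    have "lie_bracket G (basis_vec z) (lie_bracket G x x')
      = lie_bracket G (lie_bracket G (basis_vec z) x) x' + lie_bracket G x (lie_bracket G (basis_vec z) x')"
      using step.hyps(1) \<open>x \<in> basis_vec ` basis G\<close> assms(1) by (auto simp: ad_derivation_def)
    with step.IH show ?case
      by (simp add: lie_bracket_simps algebra_simps)
  qed
  with step.IH show ?case
    by (simp add: lie_bracket_simps algebra_simps)
qed

text \<open>Elements \<open>z\<close> of nonpositive weight normalize \<open>\<mm>\<close>, so for them \<open>cochain2_action\<close> is the action on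
  \<open>\<And>\<^sup>2\<mm>\<^sup>* \<otimes> \<gg>\<close> induced by the bracket, although they need not lie in \<open>\<gg>\<^sup>0\<close>.\<close>

lemma cochain2_action_coboundary1:
  assumes \<psi>: "\<psi> \<in> cochains1 G" and z: "z \<in> basis G" "wght G z \<le> 0" "ad_derivation G z"
  shows "cochain2_action G (basis_vec z) (coboundary1 G \<psi>)
    = coboundary1 G (cochain1_action (basis_vec z) \<psi>)"
proof (intro ext)
  fix x y
  define x' y' where "x' = neg_proj G x" and "y' = neg_proj G y"
  let ?z = "basis_vec z"
  note k = keys_neg_proj[of x, folded x'_def] keys_neg_proj[of y, folded y'_def]
  \<comment> \<open>Here the nonpositive weight of \<open>z\<close> enters: the brackets of
    \<open>z\<close> with \<mm> stay in \<mm>, so the coboundary formula applies to them without a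
    projection.\<close>
  note kz = keys_bracket_neg_basis[OF z(1,2) k(1)] keys_bracket_neg_basis[OF z(1,2) k(2)]
  note kxy = keys_lie_bracket_neg_basis[OF k]
  have L: "x' \<in> lie_space G" "y' \<in> lie_space G" "\<psi> x' \<in> lie_space G" "\<psi> y' \<in> lie_space G"
    by (simp_all add: x'_def y'_def cochains1_in_lie_space[OF \<psi>])
  \<comment> \<open>The Jacobi identity with \<open>z\<close> for each of the three brackets in the
    coboundary formula.\<close>
  note D = derivation_lie_bracket[OF z(3) L(1,4)] derivation_lie_bracket[OF z(3) L(2,3)]
    derivation_lie_bracket[OF z(3) L(1,2)]
  note lin = linear_add[OF cochains1_linear[OF \<psi>]] linear_diff[OF cochains1_linear[OF \<psi>]]
  have "cochain2_action G ?z (coboundary1 G \<psi>) x y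
    = lie_bracket G ?z (coboundary1 G \<psi> x' y') - coboundary1 G \<psi> (lie_bracket G ?z x') y'
      - coboundary1 G \<psi> x' (lie_bracket G ?z y')"
    by (simp add: cochain2_action_def Let_def x'_def y'_def)
  also have "\<dots> = lie_bracket G x' (cochain1_action ?z \<psi> y') - lie_bracket G y' (cochain1_action ?z \<psi> x')
      - cochain1_action ?z \<psi> (lie_bracket G x' y')"
    unfolding coboundary1_neg[OF k] coboundary1_neg[OF kz(1) k(2)] coboundary1_neg[OF k(1) kz(2)]
      cochain1_action_def neg_proj_id[OF k(1)] neg_proj_id[OF k(2)] neg_proj_id[OF kxy]
    by (simp add: lie_bracket_simps D lin)
  also have "\<dots> = coboundary1 G (cochain1_action ?z \<psi>) x' y'"
    by (simp add: coboundary1_neg k)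
  also have "\<dots> = coboundary1 G (cochain1_action ?z \<psi>) x y"
    by (simp add: coboundary1_def x'_def y'_def)
  finally show "cochain2_action G ?z (coboundary1 G \<psi>) x y
    = coboundary1 G (cochain1_action ?z \<psi>) x y" .
qed

subsection \<open>The normalization condition\<close>

text \<open>Orthogonality to all coboundaries, not only to those of positive weight, is needed for
  the invariance argument, since the adjoint of an element of \<open>\<gg>\<^sup>0\<close> may lower weights.\<close>

definition normal_cochains :: "'b cochain2 set"
  where "normal_cochains = {\<phi> \<in> weights2_in {0<..}. \<forall>\<psi>\<in>cochains1 G. ip2 \<phi> (coboundary1 G \<psi>) = 0}"

text \<open>Only test cochains with weights in \<open>W\<close> matter: the rest of \<psi> has a
  coboundary with weights outside \<open>W\<close>, which is orthogonal to \<phi>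
  automatically.\<close>

lemma normal_cochainsI:
  assumes \<phi>: "\<phi> \<in> weights2_in W" and W: "W \<subseteq> {0<..}"
    and "\<And>\<psi>. \<psi> \<in> weights1_in W \<Longrightarrow> ip2 \<phi> (coboundary1 G \<psi>) = 0"
  shows "\<phi> \<in> normal_cochains"
  unfolding normal_cochains_def
proof (intro CollectI conjI ballI)
  show "\<phi> \<in> weights2_in {0<..}"
    using \<phi> weights2_in_mono[OF W] by blast
  fix \<psi> assume "\<psi> \<in> cochains1 G"
  then have "coboundary1 G (\<psi> - part1 W \<psi>) \<in> weights2_in (- W)"
    by (intro coboundary1_in_weights2 diff_part1_in_weights)
  then have "ip2 \<phi> (coboundary1 G (\<psi> - part1 W \<psi>)) = 0"
    by (rule ip2_weights_orthogonal[OF \<phi>])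
  moreover have "ip2 \<phi> (coboundary1 G (part1 W \<psi>)) = 0"
    by (intro assms part1_in_weights)
  ultimately show "ip2 \<phi> (coboundary1 G \<psi>) = 0"
    by (simp add: linear_diff[OF linear_coboundary1] bilinear_rsub[OF bilinear_ip2])
qed

lemma subspace_normal_cochains: "subspace normal_cochains"
proof (rule subspaceI)
  show "0 \<in> normal_cochains"
    by (simp add: normal_cochains_def subspace_0[OF subspace_weights2_in] bilinear_lzero[OF bilinear_ip2])
  show "\<phi> + \<theta> \<in> normal_cochains" if "\<phi> \<in> normal_cochains" "\<theta> \<in> normal_cochains" for \<phi> \<theta>
    using that by (simp add: normal_cochains_def subspace_add[OF subspace_weights2_in] bilinear_ladd[OF bilinear_ip2])
  show "c *\<^sub>R \<phi> \<in> normal_cochains" if "\<phi> \<in> normal_cochains" for c \<phi>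
    using that by (simp add: normal_cochains_def subspace_scale[OF subspace_weights2_in] bilinear_lmul[OF bilinear_ip2])
qed

text \<open>If \<psi> has weights in \<open>W\<close>, its coboundary is orthogonal to \<phi> by
  normality and to \<open>\<phi> - part2 W \<phi>\<close> by weight, hence to
  \<open>part2 W \<phi>\<close>. This is what makes the normal cochains a graded subspace.\<close>

lemma part2_in_normal_cochains:
  assumes \<phi>: "\<phi> \<in> normal_cochains" and W: "W \<subseteq> {0<..}"
  shows "part2 W \<phi> \<in> normal_cochains"
proof (rule normal_cochainsI[OF part2_in_weights W])
  fix \<psi> assume \<psi>: "\<psi> \<in> weights1_in W"
  have "\<phi> - part2 W \<phi> \<in> weights2_in (- W)"
    using \<phi> weights2_in_cochains2 by (intro diff_part2_in_weights) (auto simp: normal_cochains_def)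
  with coboundary1_in_weights2[OF \<psi>] have "ip2 (coboundary1 G \<psi>) (\<phi> - part2 W \<phi>) = 0"
    by (rule ip2_weights_orthogonal)
  moreover have "ip2 (coboundary1 G \<psi>) \<phi> = 0"
    using \<phi> \<psi> weights1_in_cochains1 by (auto simp: normal_cochains_def ip2_commute[of _ \<phi>])
  ultimately show "ip2 (part2 W \<phi>) (coboundary1 G \<psi>) = 0"
    by (simp add: bilinear_rsub[OF bilinear_ip2] ip2_commute[of "part2 W \<phi>"])
qed

lemma action_in_normal_cochains:
  assumes \<phi>: "\<phi> \<in> normal_cochains" and z: "z \<in> basis G" "0 \<le> wght G z"
  shows "cochain2_action G (basis_vec z) \<phi> \<in> normal_cochains"
proof -
  obtain z' where z': "z' \<in> basis G" "wght G z' \<le> 0" "ad_derivation G z'" "ad_adjoint G q z z'"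
    using adjoint_ex[OF z] by blast
  have \<phi>': "\<phi> \<in> weights2_in {0<..}" "\<phi> \<in> cochains2 G"
    using \<phi> weights2_in_cochains2 by (auto simp: normal_cochains_def)
  have "ip2 (cochain2_action G (basis_vec z) \<phi>) (coboundary1 G \<psi>) = 0" if \<psi>: "\<psi> \<in> cochains1 G" for \<psi>
  proof -
    have "ip2 (cochain2_action G (basis_vec z) \<phi>) (coboundary1 G \<psi>)
      = ip2 \<phi> (coboundary1 G (cochain1_action (basis_vec z') \<psi>))"
      by (simp add: ip2_action_adjoint[OF z'(4) \<phi>'(2) coboundary1_in_cochains2[OF \<psi>]]
          cochain2_action_coboundary1[OF \<psi> z'(1-3)])
    also have "\<dots> = 0"
      using \<phi> cochain1_action_in_cochains1[OF \<psi>] z'(1) by (simp add: normal_cochains_def)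
    finally show ?thesis .
  qed
  with cochain2_action_in_weights2[OF \<phi>'(1) z] show ?thesis
    by (simp add: normal_cochains_def)
qed

lemma nonneg_part_action_in_normal_cochains:
  assumes "\<phi> \<in> normal_cochains" "z \<in> nonneg_part G"
  shows "cochain2_action G z \<phi> \<in> normal_cochains"
proof -
  have \<phi>: "bilinear \<phi>"
    using assms(1) weights2_in_cochains2 cochains2_bilinear by (auto simp: normal_cochains_def)
  have "linear (\<lambda>z. cochain2_action G z \<phi>)"
    by (rule linearI)
       (simp_all add: cochain2_action_def Let_def fun_eq_iff lie_bracket_simps
         bilinear_ladd[OF \<phi>] bilinear_radd[OF \<phi>] bilinear_lmul[OF \<phi>] bilinear_rmul[OF \<phi>] algebra_simps)
  then have sub: "subspace {z. cochain2_action G z \<phi> \<in> normal_cochains}"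
    using linear_subspace_vimage[OF _ subspace_normal_cochains] by (simp add: vimage_def)
  have "nonneg_part G \<subseteq> {z. cochain2_action G z \<phi> \<in> normal_cochains}"
    unfolding nonneg_part_def graded_part_def
    by (intro span_minimal[OF _ sub] UN_least)
       (auto intro: action_in_normal_cochains[OF assms(1)])
  with assms(2) show ?thesis by blast
qed

theorem linear_invariant_normalization_condition_normal_cochains:
  "linear_invariant_normalization_condition G normal_cochains"
  unfolding linear_invariant_normalization_condition_def
proof (intro conjI ballI)
  let ?d = "coboundary1 G" and ?P = "pos_cochains1 G"
  have P: "?P \<subseteq> cochains1 G" "?P = weights1_in {0<..}"
    using pos_cochains1_eq weights1_in_cochains1 by simp_all
  have dP: "\<theta> \<in> weights2_in {0<..}" if "\<theta> \<in> ?d ` ?P" for \<theta>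
    using that coboundary1_in_weights2 P by blast
  show "subspace normal_cochains"
    by (rule subspace_normal_cochains)
  show sub: "normal_cochains \<subseteq> pos_cochains2 G"
    by (auto simp: normal_cochains_def pos_cochains2_eq)
  show "cochain2_action G z \<phi> \<in> normal_cochains" if "z \<in> nonneg_part G" "\<phi> \<in> normal_cochains" for z \<phi>
    using that by (intro nonneg_part_action_in_normal_cochains)
  show "normal_cochains = span (\<Union>w. normal_cochains \<inter> cochains2_weight G w)"
  proof
    show "span (\<Union>w. normal_cochains \<inter> cochains2_weight G w) \<subseteq> normal_cochains"
      by (rule span_minimal[OF _ subspace_normal_cochains]) auto
    show "normal_cochains \<subseteq> span (\<Union>w. normal_cochains \<inter> cochains2_weight G w)"
    proof
      fix \<phi> assume \<phi>: "\<phi> \<in> normal_cochains"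
      then have "\<phi> \<in> span ((\<lambda>w. part2 {w} \<phi>) ` {0<..})"
        by (intro weights2_in_subset_span) (simp add: normal_cochains_def)
      moreover have "(\<lambda>w. part2 {w} \<phi>) ` {0<..} \<subseteq> (\<Union>w. normal_cochains \<inter> cochains2_weight G w)"
        using part2_in_normal_cochains[OF \<phi>] part2_in_weights by (auto simp: cochains2_weight_eq)
      ultimately show "\<phi> \<in> span (\<Union>w. normal_cochains \<inter> cochains2_weight G w)"
        using span_mono by blast
    qed
  qed
  show "normal_cochains \<inter> ?d ` ?P = {0}"
  proof
    show "normal_cochains \<inter> ?d ` ?P \<subseteq> {0}"
    proof
      fix \<phi> assume "\<phi> \<in> normal_cochains \<inter> ?d ` ?P"
      \<comment> \<open>A coboundary that is orthogonal to all coboundaries is orthogonal to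
        itself.\<close>
      then have "\<phi> \<in> cochains2 G" "ip2 \<phi> \<phi> = 0"
        using P(1) weights2_in_cochains2 by (auto simp: normal_cochains_def)
      then show "\<phi> \<in> {0}" using ip2_self_eq_0 by simp
    qed
    have "0 \<in> ?P" "?d 0 = 0"
      using P(2) subspace_0[OF subspace_weights1_in] linear_0[OF linear_coboundary1] by auto
    then show "{0} \<subseteq> normal_cochains \<inter> ?d ` ?P"
      using subspace_0[OF subspace_normal_cochains] by (auto intro: rev_image_eqI)
  qed
  show "pos_cochains2 G = {\<phi> + \<theta> |\<phi> \<theta>. \<phi> \<in> normal_cochains \<and> \<theta> \<in> ?d ` ?P}"
  proof
    show "{\<phi> + \<theta> |\<phi> \<theta>. \<phi> \<in> normal_cochains \<and> \<theta> \<in> ?d ` ?P} \<subseteq> pos_cochains2 G"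
      using sub dP subspace_add[OF subspace_weights2_in] by (auto simp: pos_cochains2_eq)
    show "pos_cochains2 G \<subseteq> {\<phi> + \<theta> |\<phi> \<theta>. \<phi> \<in> normal_cochains \<and> \<theta> \<in> ?d ` ?P}"
    proof
      fix \<phi> assume \<phi>: "\<phi> \<in> pos_cochains2 G"
      \<comment> \<open>A finite spanning set of the coboundaries of positive weight; \<theta> will
        be the orthogonal projection of \<phi> to its span.\<close>
      define T where "T = ?d ` (\<lambda>(a, k). elem1 a k) ` index1 {0<..}"
      have span_T: "span T = ?d ` ?P"
        unfolding T_def P(2) weights1_in_eq_span by (rule linear_span_image[OF linear_coboundary1])
      have "\<theta> = 0" if "\<theta> \<in> span T" "ip2 \<theta> \<theta> = 0" for \<theta>
        using that dP weights2_in_cochains2 ip2_self_eq_0 unfolding span_T by blast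
      then obtain \<theta> where \<theta>: "\<theta> \<in> span T" "\<forall>t\<in>span T. ip2 (\<phi> - \<theta>) t = 0"
        using orthogonal_projection_exists[of T ip2 \<phi>] bilinear_ip2 ip2_commute
        by (auto simp: T_def)
      have "\<phi> - \<theta> \<in> normal_cochains"
      \<comment> \<open>The projection gives orthogonality to coboundaries of positive weight; the
        weight argument extends it to all coboundaries.\<close>
      proof (rule normal_cochainsI[where W = "{0<..}"])
        show "\<phi> - \<theta> \<in> weights2_in {0<..}"
          using \<phi> \<theta>(1) dP by (intro subspace_diff[OF subspace_weights2_in]) (auto simp: pos_cochains2_eq span_T)
        show "ip2 (\<phi> - \<theta>) (?d \<psi>) = 0" if "\<psi> \<in> weights1_in {0<..}" for \<psi>
          using \<theta>(2) that by (auto simp: span_T P(2))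
      qed simp
      moreover have "\<phi> = (\<phi> - \<theta>) + \<theta>" by simp
      ultimately show "\<phi> \<in> {\<phi> + \<theta> |\<phi> \<theta>. \<phi> \<in> normal_cochains \<and> \<theta> \<in> ?d ` ?P}"
        using \<theta>(1) unfolding span_T by blast
    qed
  qed
qed

end

section \<open>The semidirect product\<close>

text \<open>The recursion \<open>|\<epsilon>\<^sub>i\<^sub>+\<^sub>1|\<^sup>2 = i (2n - 6 - i) |\<epsilon>\<^sub>i|\<^sup>2\<close> and \<open>|H|\<^sup>2 = 2 |X|\<^sup>2 = 2 |Y|\<^sup>2\<close> are forced by
  adjointness of \<open>ad X\<close> and \<open>ad Y\<close>.\<close>

fun basis_norm2 :: "nat \<Rightarrow> gl2_heis_basis \<Rightarrow> real"
  where
    "basis_norm2 n H = 2"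
  | "basis_norm2 n (Eps i) = (\<Prod>j\<in>{1..<i}. real j * (2 * real n - 6 - real j))"
  | "basis_norm2 n _ = 1"

lemma basis_norm2_Suc:
  "1 \<le> i \<Longrightarrow> basis_norm2 n (Eps (Suc i)) = real i * (2 * real n - 6 - real i) * basis_norm2 n (Eps i)"
  by (simp add: mult.commute)

lemma basis_norm2_pos:
  assumes "b \<in> basis (gl2_heis n)"
  shows "basis_norm2 n b > 0"
proof (cases b)
  case (Eps i)
  have "0 < real j * (2 * real n - 6 - real j)" if "j \<in> {1..<i}" for j
  proof -
    \<comment> \<open>From \<open>j < i\<close> and \<open>i \<le> 2 * n - 6\<close>; this makes the
      second factor positive.\<close>
    have "j + 6 < 2 * n" using that assms Eps by (auto simp: gl2_heis_def)
    then show ?thesis using that by (intro mult_pos_pos) auto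
  qed
  then show ?thesis using Eps by (auto intro: prod_pos)
qed simp_all

lemma basis_gl2_heis: "basis (gl2_heis n) = {Y, H, E, X, Eta} \<union> Eps ` {1..2 * n - 6}"
  by (simp add: gl2_heis_def)

lemma Eps_in_image_iff [simp]: "Eps i \<in> Eps ` A \<longleftrightarrow> i \<in> A"
  by auto

lemma in_basis_gl2_heis [simp]:
  "Y \<in> basis (gl2_heis n)" "H \<in> basis (gl2_heis n)" "E \<in> basis (gl2_heis n)"
  "X \<in> basis (gl2_heis n)"
  by (simp_all add: basis_gl2_heis)

lemma wght_gl2_heis [simp]:
  "wght (gl2_heis n) Y = 1" "wght (gl2_heis n) H = 0" "wght (gl2_heis n) E = 0"
  "wght (gl2_heis n) X = - 1" "wght (gl2_heis n) (Eps i) = - int i"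
  "wght (gl2_heis n) Eta = - 2 * int n + 5"
  by (simp_all add: gl2_heis_def)

lemma basis_bracket_gl2_heis: "basis_bracket (gl2_heis n) a b
  = gl2_bracket a b + heis_bracket n a b + gl2_action n a b - gl2_action n b a"
  by (simp add: gl2_heis_def)

text \<open>The action terms are antisymmetrized by construction and \<open>gl2_bracket\<close> is
  antisymmetric by its table. For the Heisenberg part the point is parity: a nonzero bracket has
  \<open>i + j = 2 * n - 5\<close>, which is odd, so the two signs are opposite.\<close>

lemma bracket_gl2_heis_antisym:
  "basis_bracket (gl2_heis n) a b = - basis_bracket (gl2_heis n) b a"
proof (cases "\<exists>i j. a = Eps i \<and> b = Eps j")
  case True
  then obtain i j where [simp]: "a = Eps i" "b = Eps j" by blast
  show ?thesis
  proof (cases "1 \<le> i \<and> i \<le> 2 * n - 6 \<and> j = 2 * n - 5 - i")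
    case True
    then have ij: "i + j = 2 * n - 5" "1 \<le> j" "j \<le> 2 * n - 6" "i = 2 * n - 5 - j" "1 \<le> i" "i \<le> 2 * n - 6"
      by auto
    have "odd (i + j)" using ij by auto
    then have "(- 1 :: real) ^ i = - ((- 1) ^ j)"
      by (cases "even i") auto
    then show ?thesis
      using ij by (simp add: basis_bracket_gl2_heis)
  next
    case False
    moreover from this have "\<not> (1 \<le> j \<and> j \<le> 2 * n - 6 \<and> i = 2 * n - 5 - j)" by auto
    ultimately show ?thesis
      unfolding basis_bracket_gl2_heis \<open>a = _\<close> \<open>b = _\<close> heis_bracket.simps by (simp only: if_False) simp
  qed
next
  case False
  then show ?thesis
    by (cases a; cases b) (auto simp: basis_bracket_gl2_heis)
qed

lemma bracket_gl2_heis_graded: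
  assumes "a \<in> basis (gl2_heis n)" "b \<in> basis (gl2_heis n)"
  shows "Poly_Mapping.keys (basis_bracket (gl2_heis n) a b)
    \<subseteq> {k \<in> basis (gl2_heis n). wght (gl2_heis n) k = wght (gl2_heis n) a + wght (gl2_heis n) b}"
  using assms
  by (cases a; cases b)
     (auto simp: basis_bracket_gl2_heis basis_gl2_heis in_keys_iff lookup_linear lookup_basis_vec
       of_nat_diff split: if_splits)

section \<open>Adjoints of \<open>Y\<close>, \<open>H\<close> and \<open>E\<close>\<close>

lemma adjoint_X_Y:
  assumes "n > 5"
  shows "ad_adjoint (gl2_heis n) (basis_norm2 n) Y X"
  unfolding ad_adjoint_def
proof (intro ballI)
  fix a b assume ab: "a \<in> basis (gl2_heis n)" "b \<in> basis (gl2_heis n)"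
  show "basis_norm2 n b * Poly_Mapping.lookup (basis_bracket (gl2_heis n) Y a) b
    = basis_norm2 n a * Poly_Mapping.lookup (basis_bracket (gl2_heis n) X b) a"
  proof (cases "\<exists>i j. a = Eps i \<and> b = Eps j")
    case True
    then obtain i j where [simp]: "a = Eps i" "b = Eps j" by blast
    show ?thesis
    proof (cases "i = Suc j")
      case True
      \<comment> \<open>The bound puts \<open>j\<close> in the range where \<open>X\<close> shifts
        \<open>\<epsilon>\<^sub>j\<close> to \<open>\<epsilon>\<^sub>j\<^sub>+\<^sub>1\<close>. For
        \<open>i = Suc j\<close> the coefficient of \<open>Y\<close> is
        \<open>j * (2 * n - 6 - j)\<close>, exactly the factor in the recursion for the
        norms.\<close>
      then have "j + 7 \<le> 2 * n" "1 \<le> j" using assms ab by (auto simp: basis_gl2_heis)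
      with True show ?thesis
        by (simp add: basis_bracket_gl2_heis lookup_linear lookup_basis_vec basis_norm2_Suc
          del: basis_norm2.simps)
    next
      case False
      then show ?thesis
        by (auto simp: basis_bracket_gl2_heis lookup_linear lookup_basis_vec)
    qed
  next
    case False
    then show ?thesis
      by (cases a; cases b) (auto simp: basis_bracket_gl2_heis lookup_linear lookup_basis_vec)
  qed
qed

text \<open>Both act diagonally on the basis, and a diagonal operator is self-adjoint whatever the
  squared norms are.\<close>

lemma adjoint_H_E:
  assumes "z = H \<or> z = E"
  shows "ad_adjoint (gl2_heis n) (basis_norm2 n) z z"
  unfolding ad_adjoint_def
proof (intro ballI)
  fix a b
  show "basis_norm2 n b * Poly_Mapping.lookup (basis_bracket (gl2_heis n) z a) b
    = basis_norm2 n a * Poly_Mapping.lookup (basis_bracket (gl2_heis n) z b) a"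
    using assms
    by (cases a; cases b) (auto simp: basis_bracket_gl2_heis lookup_linear lookup_basis_vec)
qed

section \<open>The derivation property of \<open>X\<close>, \<open>H\<close> and
  \<open>E\<close>\<close>

lemma derivation_gl2:
  assumes "z = X \<or> z = H \<or> z = E" "\<And>i. a \<noteq> Eps i" "\<And>i. b \<noteq> Eps i"
  shows "lie_bracket (gl2_heis n) (basis_vec z) (basis_bracket (gl2_heis n) a b)
    = lie_bracket (gl2_heis n) (basis_bracket (gl2_heis n) z a) (basis_vec b)
      + lie_bracket (gl2_heis n) (basis_vec a) (basis_bracket (gl2_heis n) z b)"
  using assms
  by (cases a; cases b) (auto simp: basis_bracket_gl2_heis lie_bracket_simps)

text \<open>The relation [X, Y] = H on the string of the \<open>\<epsilon>\<^sub>j\<close> comes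
  down to \<open>(j - 1) * (2 * n - 5 - j) = (2 * j + 5 - 2 * n) + j * (2 * n - 6 - j)\<close>. At
  \<open>j = 1\<close> and \<open>j = 2 * n - 6\<close> one of \<open>Y\<close>, \<open>X\<close>
  vanishes by its case distinction, and there the corresponding product in the formula is zero
  too.\<close>

lemma derivation_X_Y_Eps:
  assumes "n > 5" "1 \<le> j" "j \<le> 2 * n - 6"
  shows "lie_bracket (gl2_heis n) (basis_vec X) (basis_bracket (gl2_heis n) Y (Eps j))
    = lie_bracket (gl2_heis n) (basis_bracket (gl2_heis n) X Y) (basis_vec (Eps j))
      + lie_bracket (gl2_heis n) (basis_vec Y) (basis_bracket (gl2_heis n) X (Eps j))"
proof -
  consider "j = 1" | "2 \<le> j" "j \<le> 2 * n - 7" | "2 \<le> j" "j = 2 * n - 6"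
    using assms by linarith
  then show ?thesis
  proof cases
    case 1
    with assms show ?thesis
      by (intro poly_mapping_eqI)
         (auto simp: basis_bracket_gl2_heis lie_bracket_simps lookup_linear lookup_basis_vec
           of_nat_diff algebra_simps)
  next
    case 2
    with assms show ?thesis
      by (intro poly_mapping_eqI)
         (auto simp: basis_bracket_gl2_heis lie_bracket_simps lookup_linear lookup_basis_vec
           of_nat_diff algebra_simps)
  next
    case 3
    then have "real j = 2 * real n - 6" using assms by simp
    with 3 assms show ?thesis
      by (intro poly_mapping_eqI)
         (auto simp: basis_bracket_gl2_heis lie_bracket_simps lookup_linear lookup_basis_vec
           of_nat_diff algebra_simps)
  qed
qed

text \<open>Apart from \<open>z = X\<close> and \<open>a = Y\<close>, one of \<open>z\<close> and
  \<open>a\<close> is diagonal, or both are \<open>X\<close>, or \<open>a\<close> is the central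
  element \<eta> of the Heisenberg algebra; coordinates then settle the identity.\<close>

lemma derivation_gl2_Eps:
  assumes "n > 5" "z = X \<or> z = H \<or> z = E" "\<And>i. a \<noteq> Eps i" "b = Eps j" "1 \<le> j" "j \<le> 2 * n - 6"
  shows "lie_bracket (gl2_heis n) (basis_vec z) (basis_bracket (gl2_heis n) a b)
    = lie_bracket (gl2_heis n) (basis_bracket (gl2_heis n) z a) (basis_vec b)
      + lie_bracket (gl2_heis n) (basis_vec a) (basis_bracket (gl2_heis n) z b)"
proof (cases "z = X \<and> a = Y")
  case True
  then show ?thesis using derivation_X_Y_Eps[of n j] assms by simp
next
  case False
  with assms show ?thesis
    by (cases a; elim disjE; intro poly_mapping_eqI)
       (auto simp: basis_bracket_gl2_heis lie_bracket_simps lookup_linear lookup_basis_vec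
         of_nat_diff algebra_simps)
qed

text \<open>The Heisenberg bracket must be compatible with the action. For \<open>X\<close> the two
  terms on the right carry the signs of \<open>i + 1\<close> and \<open>i\<close> and cancel; for
  \<open>H\<close> the two eigenvalues add up to zero when \<open>i + j = 2 * n - 5\<close>; for
  \<open>E\<close> they add up to 2, the eigenvalue on \<eta>.\<close>

lemma derivation_Eps_Eps:
  assumes "n > 5" "z = X \<or> z = H \<or> z = E" "a = Eps i" "b = Eps j"
    and ij: "1 \<le> i" "i \<le> 2 * n - 6" "1 \<le> j" "j \<le> 2 * n - 6"
  shows "lie_bracket (gl2_heis n) (basis_vec z) (basis_bracket (gl2_heis n) a b)
    = lie_bracket (gl2_heis n) (basis_bracket (gl2_heis n) z a) (basis_vec b)
      + lie_bracket (gl2_heis n) (basis_vec a) (basis_bracket (gl2_heis n) z b)"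
proof -
  note [simp] = \<open>a = Eps i\<close> \<open>b = Eps j\<close>
  have eta: "lie_bracket (gl2_heis n) (basis_vec z) (basis_bracket (gl2_heis n) a b)
    = (if z = E \<and> i + j = 2 * n - 5 then (2 * (- 1) ^ i) *\<^sub>R basis_vec Eta else 0)"
    using assms(2) ij by (auto simp: basis_bracket_gl2_heis lie_bracket_simps)
  show ?thesis
  proof (cases "z = X")
    case True
    show ?thesis
    proof (cases "i + j = 2 * n - 6")
      case True
      \<comment> \<open>As both indices are at least 1, neither is at the upper end of the string,
        so \<open>X\<close> shifts both and two opposite multiples of \<eta> arise.\<close>
      with ij have "i \<le> 2 * n - 7" "j \<le> 2 * n - 7" "j = 2 * n - 5 - Suc i" "Suc j = 2 * n - 5 - i"
        "Suc i \<le> 2 * n - 6" by auto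
      with ij \<open>z = X\<close> show ?thesis
        unfolding eta by (simp add: basis_bracket_gl2_heis)
    next
      case False
      with ij have "j \<noteq> 2 * n - 5 - Suc i" "Suc j \<noteq> 2 * n - 5 - i" by auto
      with ij \<open>z = X\<close> show ?thesis
        unfolding eta by (simp add: basis_bracket_gl2_heis lie_bracket_simps)
    qed
  next
    case False
    show ?thesis
    proof (cases "i + j = 2 * n - 5")
      case True
      with ij have "j = 2 * n - 5 - i" "real j = 2 * real n - 5 - real i" by auto
      note j = this
      consider "z = H" | "z = E" using False assms(2) by blast
      then show ?thesis
      proof cases
        case 1
        with j ij show ?thesis
          unfolding eta by (simp add: basis_bracket_gl2_heis lie_bracket_simps algebra_simps)
      next
        case 2
        with j ij show ?thesis
          unfolding eta
          by (simp add: basis_bracket_gl2_heis lie_bracket_simps scaleR_add_left[symmetric])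
      qed
    next
      case False
      with ij have "j \<noteq> 2 * n - 5 - i" by auto
      with \<open>z \<noteq> X\<close> False assms(2) show ?thesis
        unfolding eta by (auto simp: basis_bracket_gl2_heis lie_bracket_simps)
    qed
  qed
qed

lemma derivation_gl2_heis:
  assumes n: "n > 5" and z: "z = X \<or> z = H \<or> z = E"
  shows "ad_derivation (gl2_heis n) z"
  unfolding ad_derivation_def
proof (intro ballI)
  fix a b assume ab: "a \<in> basis (gl2_heis n)" "b \<in> basis (gl2_heis n)"
  have Eps: "1 \<le> i" "i \<le> 2 * n - 6" if "Eps i \<in> basis (gl2_heis n)" for i
    using that by (auto simp: basis_gl2_heis)
  note antisym = lie_bracket_antisym[of "gl2_heis n", OF bracket_gl2_heis_antisym]
  consider i j where "a = Eps i" "b = Eps j"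
    | j where "\<And>i. a \<noteq> Eps i" "b = Eps j"
    | i where "a = Eps i" "\<And>j. b \<noteq> Eps j"
    | "\<And>i. a \<noteq> Eps i" "\<And>j. b \<noteq> Eps j"
    by metis
  then show "lie_bracket (gl2_heis n) (basis_vec z) (basis_bracket (gl2_heis n) a b)
    = lie_bracket (gl2_heis n) (basis_bracket (gl2_heis n) z a) (basis_vec b)
      + lie_bracket (gl2_heis n) (basis_vec a) (basis_bracket (gl2_heis n) z b)"
  proof cases
    case 1
    with derivation_Eps_Eps[OF n z 1] Eps ab show ?thesis by simp
  next
    case 2
    with derivation_gl2_Eps[OF n z 2] Eps ab(2) show ?thesis by simp
  next
    case 3
    \<comment> \<open>The identity is antisymmetric in \<open>a\<close> and \<open>b\<close>, so
      this case follows from the preceding one with the two exchanged.\<close>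
    then have "lie_bracket (gl2_heis n) (basis_vec z) (basis_bracket (gl2_heis n) b a)
      = lie_bracket (gl2_heis n) (basis_bracket (gl2_heis n) z b) (basis_vec a)
        + lie_bracket (gl2_heis n) (basis_vec b) (basis_bracket (gl2_heis n) z a)"
      using Eps ab(1) by (intro derivation_gl2_Eps[OF n z]) auto
    then show ?thesis
      unfolding bracket_gl2_heis_antisym[of n a b] antisym[of "basis_bracket (gl2_heis n) z a"]
        antisym[of "basis_vec a"]
      by (simp add: lie_bracket_simps)
  next
    case 4
    then show ?thesis by (rule derivation_gl2[OF z])
  qed
qed

theorem theorem3p7:
  fixes n :: nat
  assumes "n > 5"
  shows "\<exists>N. linear_invariant_normalization_condition (gl2_heis n) N"
proof -
  interpret graded_lie_with_adjoints "gl2_heis n" "basis_norm2 n"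
  proof
    let ?G = "gl2_heis n"
    show "finite (basis ?G)"
      by (simp add: basis_gl2_heis)
    show "basis_norm2 n b > 0" if "b \<in> basis ?G" for b
      using that by (rule basis_norm2_pos)
    show "Poly_Mapping.keys (basis_bracket ?G a b)
        \<subseteq> {k \<in> basis ?G. wght ?G k = wght ?G a + wght ?G b}"
      if "a \<in> basis ?G" "b \<in> basis ?G" for a b
      using that by (rule bracket_gl2_heis_graded)
    show "basis_bracket ?G a b = - basis_bracket ?G b a" for a b
      by (rule bracket_gl2_heis_antisym)
    fix z assume "z \<in> basis ?G" "0 \<le> wght ?G z"
    \<comment> \<open>For \<open>n > 5\<close> the weight \<open>5 - 2 * n\<close> of \<eta> is
      negative, so \<eta> belongs to \<mm>, as do \<open>X\<close> and all
      \<open>\<epsilon>\<^sub>i\<close>.\<close>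
    then have "z = Y \<or> z = H \<or> z = E"
      using assms by (auto simp: basis_gl2_heis)
    \<comment> \<open>The witness is \<open>X\<close>, of weight -1, for \<open>Y\<close>; the
      elements \<open>H\<close> and \<open>E\<close> are their own witnesses.\<close>
    then show "\<exists>z'\<in>basis ?G. wght ?G z' \<le> 0 \<and> ad_adjoint ?G (basis_norm2 n) z z' \<and> ad_derivation ?G z'"
      using adjoint_X_Y[OF assms] adjoint_H_E[of _ n] derivation_gl2_heis[OF assms]
      by (elim disjE; intro bexI[of _ "if z = Y then X else z"]) simp_all
  qed
  show ?thesis
    using linear_invariant_normalization_condition_normal_cochains by blast
qed

end
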